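(* Let $x=(x_1,x_2,\dots)$ and $y=(y_1,y_2,\dots)$ be two sets of variables and let $\mathcal P$ be the set of all partitions. Then $$\prod_{i,\,j\geqslant 1}\frac{1-a_i\,y_j}{1-x_i\,y_j}=\sum_{\lambda\in\mathcal P}s_\lambda(x\|a)\,\widehat s_\lambda(y\|a),$$ where $s_\lambda(x\|a)$ are the double Schur functions and $\widehat s_\lambda(y\|a)$ are the dual Schur functions.
   Context: Let $a=(a_i)_{i\in\mathbb Z}$ be a sequence of commuting indeterminates and $\mathbb Q[a]$ the polynomial ring in the $a_i$. The ring $\Lambda(x\|a)$: its elements are sequences $P=(P_0,P_1,P_2,\dots)$, where $P_n$ is a symmetric polynomial in $x_1,\dots,x_n$ with coefficients in $\mathbb Q[a]$, the total degrees of the $P_n$ in the $x_i$ are bounded, and $P_n(x_1,\dots,x_{n-1},a_n)=P_{n-1}(x_1,\dots,x_{n-1})$ for all $n\geqslant 1$; multiplication is componentwise. Double Schur functions: for a partition $\lambda$ with length $\ell(\lambda)\leqslant n$, $$s_\lambda(x_1,\dots,x_n\|a)=\frac{\det\big[(x_i\|a)^{\lambda_j+n-j}\big]_{i,j=1}^n}{\prod_{1\leqslant i<j\leqslant n}(x_i-x_j)},\qquad (x_i\|a)^r=(x_i-a_n)(x_i-a_{n-1})\cdots(x_i-a_{n-r+1}),\ (x_i\|a)^0=1,$$ and $s_\lambda(x_1,\dots,x_n\|a)=0$ if $\ell(\lambda)>n$. This sequence (over $n$) is the element $s_\lambda(x\|a)\in\Lambda(x\|a)$. Dual Schur functions: let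 $\widehat\Lambda(y\|a)$ be the ring of formal (possibly infinite) sums $\sum_{\lambda}c_\lambda(a)s_\lambda(y)$, $c_\lambda(a)\in\mathbb Q[a]$, where $s_\lambda(y)$ are the ordinary Schur functions. Let $d$ be the number of boxes on the main diagonal of $\lambda$. For $n\geqslant\ell(\lambda)$, $$\widehat s_\lambda(y_1,\dots,y_n\|a)=\frac{\det[A_{ij}]_{i,j=1}^n}{\prod_{1\leqslant i<j\leqslant n}(y_i-y_j)},$$ where $A_{ij}=\dfrac{y_i^{\lambda_j+n-j}}{(1-a_0y_i)(1-a_{-1}y_i)\cdots(1-a_{j-\lambda_j}y_i)}$ for $1\leqslant j\leqslant d$ and $A_{ij}=y_i^{\lambda_j+n-j}(1-a_1y_i)(1-a_2y_i)\cdots(1-a_{j-\lambda_j-1}y_i)$ for $d<j\leqslant n$ (expanded as power series in $y$); it is set to $0$ if $\ell(\lambda)>n$. These are compatible with setting $y_n=0$ and define the element $\widehat s_\lambda(y\|a)\in\widehat\Lambda(y\|a)$. Meaning of the identity: for each $n$ replace $x$ by $(x_1,\dots,x_n)$, with $i$ in the product running over $1,\dots,n$; this is then an identity of formal power series in $y$. The coefficients of monomials in $y$, for $n=0,1,2,\dots$, form elements of $\Lambda(x\|a)$. *)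

theory Defs
  imports
    "HOL-Library.Poly_Mapping"
    "HOL-Analysis.Infinite_Sum"
    "HOL-Analysis.Infinite_Products"
    "Jordan_Normal_Form.Determinant"
begin

section \<open>Multivariate polynomials\<close>

text \<open>A polynomial is a finitely supported function from monomials (exponent vectors) to
  coefficients; the ring structure is the convolution product of \<^theory>\<open>HOL-Library.Poly_Mapping\<close>.\<close>

type_synonym ('v, 'r) mpoly = "('v \<Rightarrow>\<^sub>0 nat) \<Rightarrow>\<^sub>0 'r"

definition Const :: "'r \<Rightarrow> ('v, 'r::comm_ring_1) mpoly" where
  "Const c = Poly_Mapping.single 0 c"

definition Var :: "'v \<Rightarrow> ('v, 'r::comm_ring_1) mpoly" where
  "Var v = Poly_Mapping.single (Poly_Mapping.single v 1) 1"

definition mpoly_subst ::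
    "('v \<Rightarrow> ('w, 'r) mpoly) \<Rightarrow> ('v, 'r::comm_ring_1) mpoly \<Rightarrow> ('w, 'r) mpoly" where
  "mpoly_subst f p =
     (\<Sum>m\<in>Poly_Mapping.keys p. Const (Poly_Mapping.lookup p m) *
        (\<Prod>v\<in>Poly_Mapping.keys m. f v ^ Poly_Mapping.lookup m v))"

definition monom_degree :: "('v \<Rightarrow>\<^sub>0 nat) \<Rightarrow> nat" where
  "monom_degree m = (\<Sum>v\<in>Poly_Mapping.keys m. Poly_Mapping.lookup m v)"


section \<open>Formal power series in infinitely many variables\<close>

typedef 'r mfps = "UNIV :: ((nat \<Rightarrow>\<^sub>0 nat) \<Rightarrow> 'r) set"
  morphisms mfps_coeff Abs_mfps
  by simp

lemma mfps_coeff_Abs [simp]: "mfps_coeff (Abs_mfps f) = f"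
  by (simp add: Abs_mfps_inverse)

lemma mfps_eqI: "(\<And>m. mfps_coeff f m = mfps_coeff g m) \<Longrightarrow> f = g"
  by (metis ext mfps_coeff_inverse)

lemma finite_monom_splits: "finite {(p, q). p + q = (m :: 'v \<Rightarrow>\<^sub>0 nat)}"
proof -
  let ?B = "\<Union>v\<in>Poly_Mapping.keys m. {..Poly_Mapping.lookup m v}"
  let ?F = "{f. \<forall>v. (v \<in> Poly_Mapping.keys m \<longrightarrow> f v \<in> ?B) \<and> (v \<notin> Poly_Mapping.keys m \<longrightarrow> f v = 0)}"
  have "finite ?F"
    by (rule finite_set_of_finite_funs) auto
  moreover have "Poly_Mapping.lookup ` {p. \<exists>q. p + q = m} \<subseteq> ?F"
  proof
    fix f
    assume "f \<in> Poly_Mapping.lookup ` {p. \<exists>q. p + q = m}"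
    then have le: "f v \<le> Poly_Mapping.lookup m v" for v
      by (auto simp: lookup_add)
    have "f v \<in> ?B" if "v \<in> Poly_Mapping.keys m" for v
      using that le by blast
    moreover have "f v = 0" if "v \<notin> Poly_Mapping.keys m" for v
      using that le [of v] by (simp add: in_keys_iff)
    ultimately show "f \<in> ?F"
      by blast
  qed
  moreover have "inj_on Poly_Mapping.lookup {p. \<exists>q. p + q = m}"
    by (simp add: inj_on_def)
  ultimately have fin: "finite {p. \<exists>q. p + q = m}"
    using finite_imageD finite_subset by blast
  have "{(p, q). p + q = m} \<subseteq> (\<lambda>p. (p, m - p)) ` {p. \<exists>q. p + q = m}"
    by auto
  then show ?thesis
    using fin finite_surj by blast
qed

instantiation mfps :: (comm_ring_1) comm_ring_1
begin

definition "0 = Abs_mfps (\<lambda>_. 0)"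
definition "1 = Abs_mfps (\<lambda>m. if m = 0 then 1 else 0)"
definition "f + g = Abs_mfps (\<lambda>m. mfps_coeff f m + mfps_coeff g m)"
definition "- f = Abs_mfps (\<lambda>m. - mfps_coeff f m)"
definition "f - g = Abs_mfps (\<lambda>m. mfps_coeff f m - mfps_coeff g m)"
definition "f * g =
  Abs_mfps (\<lambda>m. \<Sum>(p, q) | p + q = m. mfps_coeff f p * mfps_coeff g q)"

instance
proof
  fix f g h :: "'a mfps"
  show "f * g * h = f * (g * h)"
  proof (rule mfps_eqI)
    fix m
    let ?S = "\<lambda>m. {(p, q). p + q = (m :: nat \<Rightarrow>\<^sub>0 nat)}"
    have "mfps_coeff (f * g * h) m =
        (\<Sum>u\<in>?S m. \<Sum>w\<in>?S (fst u).
           mfps_coeff f (fst w) * mfps_coeff g (snd w) * mfps_coeff h (snd u))"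
      by (simp add: times_mfps_def case_prod_beta sum_distrib_right)
    also have "\<dots> = (\<Sum>(u, w)\<in>Sigma (?S m) (\<lambda>u. ?S (fst u)).
           mfps_coeff f (fst w) * mfps_coeff g (snd w) * mfps_coeff h (snd u))"
      by (rule sum.Sigma) (auto simp: finite_monom_splits)
    also have "\<dots> = (\<Sum>(u, w)\<in>Sigma (?S m) (\<lambda>u. ?S (snd u)).
           mfps_coeff f (fst u) * (mfps_coeff g (fst w) * mfps_coeff h (snd w)))"
      by (rule sum.reindex_bij_witness
          [where i = "\<lambda>(u, w). ((fst u + fst w, snd w), (fst u, fst w))"
             and j = "\<lambda>(u, w). ((fst w, snd w + snd u), (snd w, snd u))"])
         (auto simp: add.assoc mult.assoc)
    also have "\<dots> = (\<Sum>u\<in>?S m. \<Sum>w\<in>?S (snd u).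
           mfps_coeff f (fst u) * (mfps_coeff g (fst w) * mfps_coeff h (snd w)))"
      by (rule sum.Sigma [symmetric]) (auto simp: finite_monom_splits)
    also have "\<dots> = mfps_coeff (f * (g * h)) m"
      by (simp add: times_mfps_def case_prod_beta sum_distrib_left)
    finally show "mfps_coeff (f * g * h) m = mfps_coeff (f * (g * h)) m" .
  qed
  show "f * g = g * f"
  proof (rule mfps_eqI)
    fix m
    show "mfps_coeff (f * g) m = mfps_coeff (g * f) m"
      unfolding times_mfps_def mfps_coeff_Abs
      by (rule sum.reindex_bij_witness [where i = prod.swap and j = prod.swap])
         (auto simp: add.commute mult.commute)
  qed
  show "1 * f = f"
  proof (rule mfps_eqI)
    fix m
    have "mfps_coeff (1 * f) m =
        (\<Sum>u\<in>{(p, q). p + q = m}. if u = (0, m) then mfps_coeff f m else 0)"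
      unfolding times_mfps_def one_mfps_def mfps_coeff_Abs
      by (rule sum.cong) (auto split: if_splits)
    also have "\<dots> = mfps_coeff f m"
      by (subst sum.delta) (auto simp: finite_monom_splits)
    finally show "mfps_coeff (1 * f) m = mfps_coeff f m" .
  qed
  show "(f + g) * h = f * h + g * h"
    by (rule mfps_eqI)
       (simp add: times_mfps_def plus_mfps_def case_prod_beta distrib_right sum.distrib)
  have "mfps_coeff (0 :: 'a mfps) 0 \<noteq> mfps_coeff 1 0"
    by (simp add: zero_mfps_def one_mfps_def)
  then show "(0 :: 'a mfps) \<noteq> 1"
    by metis
  show "f + g + h = f + (g + h)" "f + g = g + f" "0 + f = f" "- f + f = 0" "f - g = f + - g"
    by (rule mfps_eqI;
        simp add: zero_mfps_def plus_mfps_def uminus_mfps_def minus_mfps_def algebra_simps)+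
qed

end

text \<open>The topology of coefficientwise convergence, i.e. the product of the discrete topologies
  on the coefficients. With it, the library's infinite sums and products are the formal ones.\<close>

instantiation mfps :: (type) t2_space
begin

definition open_mfps_def: "open (U :: 'a mfps set) \<longleftrightarrow>
  (\<forall>f\<in>U. \<exists>M. finite M \<and> {g. \<forall>m\<in>M. mfps_coeff g m = mfps_coeff f m} \<subseteq> U)"

instance
proof
  show "open (UNIV :: 'a mfps set)"
    unfolding open_mfps_def by (intro ballI exI [of _ "{}"]) simp
next
  fix S T :: "'a mfps set"
  assume S: "open S" and T: "open T"
  show "open (S \<inter> T)"
    unfolding open_mfps_def
  proof
    fix f assume f: "f \<in> S \<inter> T"
    obtain M where M: "finite M" "{g. \<forall>m\<in>M. mfps_coeff g m = mfps_coeff f m} \<subseteq> S"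
      using S f unfolding open_mfps_def by blast
    obtain N where N: "finite N" "{g. \<forall>m\<in>N. mfps_coeff g m = mfps_coeff f m} \<subseteq> T"
      using T f unfolding open_mfps_def by blast
    from M N have "finite (M \<union> N) \<and>
        {g. \<forall>m\<in>M \<union> N. mfps_coeff g m = mfps_coeff f m} \<subseteq> S \<inter> T"
      by (simp add: subset_iff)
    then show "\<exists>M. finite M \<and> {g. \<forall>m\<in>M. mfps_coeff g m = mfps_coeff f m} \<subseteq> S \<inter> T"
      by blast
  qed
next
  fix K :: "'a mfps set set"
  assume "\<forall>S\<in>K. open S"
  then show "open (\<Union>K)"
    unfolding open_mfps_def by (meson Sup_upper UnionE subset_trans)
next
  fix f g :: "'a mfps"
  assume "f \<noteq> g"
  then obtain m where m: "mfps_coeff f m \<noteq> mfps_coeff g m"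
    using mfps_eqI by blast
  let ?U = "\<lambda>f. {h. mfps_coeff h m = mfps_coeff f m} :: 'a mfps set"
  have "open (?U h)" for h
    unfolding open_mfps_def by (intro ballI exI [of _ "{m}"]) auto
  then show "\<exists>U V. open U \<and> open V \<and> f \<in> U \<and> g \<in> V \<and> U \<inter> V = {}"
    using m by (intro exI [of _ "?U f"] exI [of _ "?U g"]) auto
qed

end

definition mfps_const :: "'r \<Rightarrow> 'r::comm_ring_1 mfps" where
  "mfps_const c = Abs_mfps (\<lambda>m. if m = 0 then c else 0)"

definition mfps_var :: "nat \<Rightarrow> 'r::comm_ring_1 mfps" where
  "mfps_var j = Abs_mfps (\<lambda>m. if m = Poly_Mapping.single j 1 then 1 else 0)"

definition mfps_map :: "('r \<Rightarrow> 's) \<Rightarrow> 'r mfps \<Rightarrow> 's mfps" where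
  "mfps_map h f = Abs_mfps (\<lambda>m. h (mfps_coeff f m))"

text \<open>Setting \<open>y\<^sub>j = 0\<close> for all \<open>j > n\<close>. Every monomial survives for large \<open>n\<close>, so a power
  series is determined by its truncations.\<close>

definition mfps_truncate :: "nat \<Rightarrow> 'r::zero mfps \<Rightarrow> 'r mfps" where
  "mfps_truncate n f =
     Abs_mfps (\<lambda>m. if Poly_Mapping.keys m \<subseteq> {..n} then mfps_coeff f m else 0)"

text \<open>Quotients are taken inside the ring at hand. All divisors used below are non-zero-divisors
  (products of differences of variables, power series with constant term \<open>1\<close>), so that the
  quotient is unique.\<close>

definition exact_quot :: "'r::comm_ring_1 \<Rightarrow> 'r \<Rightarrow> 'r" where
  "exact_quot p q = (THE r. r * q = p)"


section \<open>Partitions\<close>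

definition partitions :: "nat list set" where
  "partitions = {lam. sorted_wrt (\<ge>) lam \<and> 0 \<notin> set lam}"

definition part :: "nat list \<Rightarrow> nat \<Rightarrow> nat" where
  "part lam j = (if 1 \<le> j \<and> j \<le> length lam then lam ! (j - 1) else 0)"

definition diagonal_length :: "nat list \<Rightarrow> nat" where
  "diagonal_length lam = card {i \<in> {1..length lam}. i \<le> part lam i}"


section \<open>The ring \<open>\<Lambda>(x\<parallel>a)\<close> and the double Schur functions\<close>

text \<open>\<open>apoly\<close> is \<open>\<rat>[a]\<close> and \<open>xpoly\<close> is \<open>\<rat>[a][x]\<close>. The variables \<open>x\<^sub>1, x\<^sub>2, \<dots>\<close> and
  \<open>y\<^sub>1, y\<^sub>2, \<dots>\<close> are numbered from \<open>1\<close>; those with index \<open>0\<close> are never used. Matrix entries of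
  \<^const>\<open>mat\<close> are numbered from \<open>0\<close>, whence the occurrences of \<^const>\<open>Suc\<close>.\<close>

type_synonym apoly = "(int, rat) mpoly"
type_synonym xpoly = "(nat, apoly) mpoly"

definition avar :: "int \<Rightarrow> apoly" where
  "avar k = Var k"

definition double_symmetric_functions :: "(nat \<Rightarrow> xpoly) set" where
  "double_symmetric_functions =
     {P. (\<forall>n. \<forall>m\<in>Poly_Mapping.keys (P n). Poly_Mapping.keys m \<subseteq> {1..n}) \<and>
         (\<forall>n \<pi>. \<pi> permutes {1..n} \<longrightarrow> mpoly_subst (\<lambda>i. Var (\<pi> i)) (P n) = P n) \<and>
         (\<exists>D. \<forall>n. \<forall>m\<in>Poly_Mapping.keys (P n). monom_degree m \<le> D) \<and>
         (\<forall>n\<ge>1. mpoly_subst (\<lambda>i. if i = n then Const (avar (int n)) else Var i) (P n) = P (n - 1))}"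

text \<open>\<open>(x\<^sub>i\<parallel>a)\<^sup>r\<close>, which depends on the number \<open>n\<close> of variables.\<close>

definition factorial_power :: "nat \<Rightarrow> nat \<Rightarrow> nat \<Rightarrow> xpoly" where
  "factorial_power n i r = (\<Prod>k<r. Var i - Const (avar (int n - int k)))"

definition double_schur :: "nat list \<Rightarrow> nat \<Rightarrow> xpoly" where
  "double_schur lam n =
     (if length lam \<le> n then
        exact_quot
          (Determinant.det (mat n n (\<lambda>(i, j).
             factorial_power n (Suc i) (part lam (Suc j) + n - Suc j))))
          (\<Prod>i=1..n. \<Prod>j=i+1..n. Var i - Var j)
      else 0)"


section \<open>The dual Schur functions\<close>

definition dual_schur_entry :: "nat list \<Rightarrow> nat \<Rightarrow> nat \<Rightarrow> nat \<Rightarrow> apoly mfps" where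
  "dual_schur_entry lam n i j =
     (if j \<le> diagonal_length lam then
        exact_quot (mfps_var i ^ (part lam j + n - j))
          (\<Prod>k = int j - int (part lam j)..0. 1 - mfps_const (avar k) * mfps_var i)
      else
        mfps_var i ^ (part lam j + n - j) *
          (\<Prod>k = 1..int j - int (part lam j) - 1. 1 - mfps_const (avar k) * mfps_var i))"

definition dual_schur_finite :: "nat list \<Rightarrow> nat \<Rightarrow> apoly mfps" where
  "dual_schur_finite lam n =
     (if length lam \<le> n then
        exact_quot
          (Determinant.det (mat n n (\<lambda>(i, j). dual_schur_entry lam n (Suc i) (Suc j))))
          (\<Prod>i=1..n. \<Prod>j=i+1..n. mfps_var i - mfps_var j)
      else 0)"

text \<open>The element of the completed ring defined by the compatible sequence of its restrictions
  to finitely many variables.\<close>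

definition dual_schur :: "nat list \<Rightarrow> apoly mfps" where
  "dual_schur lam = (THE F. \<forall>n. mfps_truncate n F = dual_schur_finite lam n)"

end

theory Submission
  imports Defs
begin

text \<open>
  With \<open>\<alpha>\<^sub>j = \<lambda>\<^sub>j + n - j\<close> the numerators of the two Schur functions are \<open>det [f\<^sub>\<alpha>\<^sub>j(x\<^sub>i)]\<close> and
  \<open>det [g\<^sub>\<alpha>\<^sub>j(y\<^sub>i)]\<close> for one-variable functions \<open>f\<^sub>\<alpha>\<close> and \<open>g\<^sub>\<alpha>\<close> that do not depend on \<open>\<lambda>\<close>. For \<open>n\<close> variables
  \<open>x\<close> and \<open>n\<close> variables \<open>y\<close>, the Cauchy--Binet formula turns the sum over \<open>\<lambda>\<close> into
  \<open>det [\<Sum>\<^sub>\<alpha> f\<^sub>\<alpha>(x\<^sub>i) g\<^sub>\<alpha>(y\<^sub>j)]\<close>. The inner sum telescopes to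
  \<open>(1 - a\<^sub>1 y\<^sub>j) \<cdots> (1 - a\<^sub>n y\<^sub>j) / (1 - x\<^sub>i y\<^sub>j)\<close>, so that Cauchy's determinant gives the product side.
  The sums are cut off at \<open>\<alpha> < M\<close>, at the price of an error of order at least \<open>M\<close> in \<open>y\<close>. Since
  \<open>s\<^sub>\<lambda>(x\<parallel>a)\<close> is stable under \<open>x\<^sub>n = a\<^sub>n\<close> and the dual functions under \<open>y\<^sub>n = 0\<close>, a coefficient of the
  general identity is a specialization of one with equally many \<open>x\<close> and \<open>y\<close>.
\<close>

section \<open>Determinants\<close>

lemma det_mat_eq_sum:
  "Determinant.det (mat n n (\<lambda>(i, j). f i j)) =
     (\<Sum>p | p permutes {0..<n}. signof p * (\<Prod>i = 0..<n. f i (p i)))"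
  by (auto simp: det_def' [of _ n] permutes_in_image intro!: sum.cong prod.cong)

lemma det_scale:
  "Determinant.det (mat n n (\<lambda>(i, j). r i * c j * v i j)) =
     (\<Prod>i<n. r i) * (\<Prod>j<n. c j) * Determinant.det (mat n n (\<lambda>(i, j). v i j))"
proof -
  have "(\<Prod>i = 0..<n. c (p i)) = (\<Prod>j<n. c j)" if "p permutes {0..<n}" for p
    using prod.permute [OF that, of c] by (simp add: comp_def lessThan_atLeast0)
  then show ?thesis
    unfolding det_mat_eq_sum
    by (auto simp: prod.distrib sum_distrib_left lessThan_atLeast0 ac_simps intro!: sum.cong)
qed

text \<open>Elimination without division: subtracting \<open>r i\<close> times the last row from row
  \<open>i\<close> clears the last column above the pivot. The operation is left multiplication by a
  unitriangular matrix, after which only the corner survives in the Laplace expansion.\<close>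

lemma det_pivot:
  fixes u :: "nat \<Rightarrow> nat \<Rightarrow> 'a::comm_ring_1"
  assumes r: "\<And>i. i < n \<Longrightarrow> u i n = r i * u n n"
  shows "Determinant.det (mat (Suc n) (Suc n) (\<lambda>(i, j). u i j)) =
           u n n * Determinant.det (mat n n (\<lambda>(i, j). u i j - r i * u n j))"
proof -
  let ?U = "mat (Suc n) (Suc n) (\<lambda>(i, j). u i j)"
  let ?L = "mat (Suc n) (Suc n) (\<lambda>(i, j). if i = j then 1 else if j = n then - r i else 0)"
  let ?C = "mat (Suc n) (Suc n) (\<lambda>(i, j). if i = n then u n j else u i j - r i * u n j)"
  have det_L: "Determinant.det ?L = 1"
    by (subst det_upper_triangular [of _ "Suc n"]) (auto simp: prod_list_diag_prod)
  have "?L * ?U = ?C"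
  proof (rule eq_matI)
    fix i j assume "i < dim_row ?C" "j < dim_col ?C"
    then have i: "i < Suc n" and j: "j < Suc n" by auto
    have "(?L * ?U) $$ (i, j) = (\<Sum>k = 0..<Suc n. ?L $$ (i, k) * ?U $$ (k, j))"
      using i j by (simp add: scalar_prod_def)
    also have "\<dots> = (\<Sum>k = 0..<n. ?L $$ (i, k) * ?U $$ (k, j)) + (if i = n then 1 else - r i) * u n j"
      using i j by simp
    also have "(\<Sum>k = 0..<n. ?L $$ (i, k) * ?U $$ (k, j)) = (\<Sum>k = 0..<n. if k = i then u k j else 0)"
      using i j by (intro sum.cong) auto
    also have "\<dots> + (if i = n then 1 else - r i) * u n j = ?C $$ (i, j)"
      using i j by auto
    finally show "(?L * ?U) $$ (i, j) = ?C $$ (i, j)" .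
  qed auto
  then have "Determinant.det ?U = Determinant.det ?C"
    using det_mult [of ?L "Suc n" ?U] det_L by simp
  also have "\<dots> = (\<Sum>i<Suc n. ?C $$ (i, n) * cofactor ?C i n)"
    by (rule laplace_expansion_column) auto
  also have "\<dots> = u n n * cofactor ?C n n"
    using r by simp
  also have "mat_delete ?C n n = mat n n (\<lambda>(i, j). u i j - r i * u n j)"
    by (rule eq_matI) (auto simp: mat_delete_def)
  then have "cofactor ?C n n = Determinant.det (mat n n (\<lambda>(i, j). u i j - r i * u n j))"
    by (simp add: cofactor_def flip: power_mult_distrib mult_2)
  finally show ?thesis .
qed

text \<open>This is \<open>det_pivot\<close> for the transpose with multipliers 0. It serves both
  stability proofs, where specializing the last variable kills the last row except possibly its
  corner.\<close>

lemma det_last_row_unit: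
  fixes u :: "nat \<Rightarrow> nat \<Rightarrow> 'a::comm_ring_1"
  assumes "\<And>j. j < n \<Longrightarrow> u n j = 0"
  shows "Determinant.det (mat (Suc n) (Suc n) (\<lambda>(i, j). u i j)) =
           u n n * Determinant.det (mat n n (\<lambda>(i, j). u i j))"
proof -
  have t: "Determinant.det (mat k k (\<lambda>(i, j). u i j)) = Determinant.det (mat k k (\<lambda>(i, j). u j i))" for k
    by (subst det_transpose [of _ k, symmetric]) (auto intro!: arg_cong [where f = Determinant.det])
  show ?thesis
    using det_pivot [of n "\<lambda>i j. u j i" "\<lambda>_. 0"] assms by (simp add: t)
qed

lemma det_last_row_zero:
  fixes u :: "nat \<Rightarrow> nat \<Rightarrow> 'a::comm_ring_1"
  assumes "\<And>j. j \<le> n \<Longrightarrow> u n j = 0"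
  shows "Determinant.det (mat (Suc n) (Suc n) (\<lambda>(i, j). u i j)) = 0"
  using det_last_row_unit [of n u] assms by simp

section \<open>Vandermonde products and Cauchy's determinant\<close>

definition vdm :: "nat \<Rightarrow> (nat \<Rightarrow> 'a::comm_ring_1) \<Rightarrow> 'a" where
  "vdm n x = (\<Prod>i=1..n. \<Prod>j=i+1..n. x i - x j)"

lemma vdm_0 [simp]: "vdm 0 x = 1"
  by (simp add: vdm_def)

lemma vdm_Suc: "vdm (Suc n) x = vdm n x * (\<Prod>i<n. x (Suc i) - x (Suc n))"
proof -
  have "(\<Prod>i=1..n. \<Prod>j=i+1..Suc n. x i - x j) =
      (\<Prod>i=1..n. (\<Prod>j=i+1..n. x i - x j) * (x i - x (Suc n)))"
    by (rule prod.cong) auto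
  then show ?thesis
    by (simp add: vdm_def prod.distrib prod.atLeast1_atMost_eq)
qed

text \<open>The reciprocals are given by the equation they satisfy, so the ring need not be a field.
  Pivoting on the last entry leaves a matrix that is again of Cauchy type up to row and column
  factors, and these factors extend both Vandermonde products.\<close>

lemma det_cauchy:
  fixes x y :: "nat \<Rightarrow> 'a::comm_ring_1"
  assumes "\<And>i j. i < n \<Longrightarrow> j < n \<Longrightarrow> u i j * (1 - x (Suc i) * y (Suc j)) = 1"
  shows "Determinant.det (mat n n (\<lambda>(i, j). u i j)) = vdm n x * vdm n y * (\<Prod>i<n. \<Prod>j<n. u i j)"
  using assms
proof (induction n)
  case (Suc n)
  let ?r = "\<lambda>i. u i n * (1 - x (Suc n) * y (Suc n))"
  have unn: "u n n * (1 - x (Suc n) * y (Suc n)) = 1"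
    using Suc.prems by simp
  have entry: "u i j - ?r i * u n j =
      (u i n * (x (Suc i) - x (Suc n))) * (u n j * (y (Suc j) - y (Suc n))) * u i j"
    if "i < n" "j < n" for i j
  proof -
    have e: "u i j * (1 - x (Suc i) * y (Suc j)) = 1" "u i n * (1 - x (Suc i) * y (Suc n)) = 1"
      "u n j * (1 - x (Suc n) * y (Suc j)) = 1"
      using Suc.prems that by auto
    \<comment> \<open>Multiplying each term by factors equal to 1 brings both to the common
      denominator of three reciprocals.\<close>
    have "u i j - ?r i * u n j =
        u i j * (u i n * (1 - x (Suc i) * y (Suc n))) * (u n j * (1 - x (Suc n) * y (Suc j)))
        - (u i j * (1 - x (Suc i) * y (Suc j))) * (?r i * u n j)"
      by (simp only: e mult_1_right mult_1_left)
    also have "\<dots> = (u i n * (x (Suc i) - x (Suc n))) * (u n j * (y (Suc j) - y (Suc n))) * u i j"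
      by (simp add: algebra_simps)
    finally show ?thesis .
  qed
  have "Determinant.det (mat (Suc n) (Suc n) (\<lambda>(i, j). u i j)) =
      u n n * Determinant.det (mat n n (\<lambda>(i, j). u i j - ?r i * u n j))"
    by (rule det_pivot) (use unn in \<open>simp add: ac_simps\<close>)
  also have "mat n n (\<lambda>(i, j). u i j - ?r i * u n j) = mat n n (\<lambda>(i, j).
      (u i n * (x (Suc i) - x (Suc n))) * (u n j * (y (Suc j) - y (Suc n))) * u i j)"
    by (rule eq_matI) (simp_all add: entry)
  also have "Determinant.det \<dots> = (\<Prod>i<n. u i n * (x (Suc i) - x (Suc n))) *
      (\<Prod>j<n. u n j * (y (Suc j) - y (Suc n))) * (vdm n x * vdm n y * (\<Prod>i<n. \<Prod>j<n. u i j))"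
    using Suc by (simp add: det_scale)
  finally show ?case
    by (simp add: vdm_Suc prod.distrib ac_simps)
qed simp

text \<open>The matrix \<open>p\<^sub>j(y\<^sub>i)\<close> is the product of a triangular matrix of Newton basis
  polynomials and the matrix of divided differences of the \<open>p\<^sub>j\<close>.\<close>

primrec newton_rest :: "(nat \<Rightarrow> 'a::comm_ring_1) \<Rightarrow> 'a poly \<Rightarrow> nat \<Rightarrow> 'a poly" where
  "newton_rest y p 0 = p"
| "newton_rest y p (Suc m) = synthetic_div (newton_rest y p m) (y m)"

text \<open>Newton interpolation with remainder, from iterating p(t) = p(c) + (t - c) q(t).
  Synthetic division replaces quotients of differences, so any commutative ring is allowed; at a
  node \<open>y k\<close> with \<open>k < n\<close> the remainder vanishes.\<close>

lemma poly_newton: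
  "poly p t = (\<Sum>m<n. (\<Prod>k<m. t - y k) * poly (newton_rest y p m) (y m)) +
     (\<Prod>k<n. t - y k) * poly (newton_rest y p n) t"
proof (induction n)
  case (Suc n)
  have step: "poly (newton_rest y p n) t =
      poly (newton_rest y p n) (y n) + (t - y n) * poly (newton_rest y p (Suc n)) t"
    using arg_cong [OF synthetic_div_correct [of "newton_rest y p n" "y n"], of "\<lambda>p. poly p t"]
    by (simp add: algebra_simps)
  show ?case
    by (subst Suc, subst step) (simp add: algebra_simps)
qed simp

text \<open>Provides the quotients that \<open>exact_quot\<close> asks for in both kinds of Schur
  functions. The triangular factor \<open>?L\<close> has the Vandermonde product, up to sign, as its
  determinant.\<close>

lemma vdm_dvd_det_poly:
  fixes y :: "nat \<Rightarrow> 'a::comm_ring_1"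
  shows "vdm n y dvd Determinant.det (mat n n (\<lambda>(i, j). poly (p j) (y (Suc i))))"
proof -
  let ?y = "\<lambda>k. y (Suc k)"
  let ?L = "mat n n (\<lambda>(i, m). \<Prod>k<m. y (Suc i) - y (Suc k))"
  let ?Q = "mat n n (\<lambda>(m, j). poly (newton_rest ?y (p j) m) (y (Suc m)))"
  have zero: "(\<Prod>k<m. y (Suc i) - y (Suc k)) = 0" if "i < m" for i m
    using that by (auto intro!: prod_zero)
  have "Determinant.det ?L = (\<Prod>i<n. \<Prod>k<i. y (Suc i) - y (Suc k))"
    by (subst det_lower_triangular [of n]) (auto simp: zero [unfolded lessThan_atLeast0] prod_list_diag_prod lessThan_atLeast0)
  also have "\<dots> = (\<Prod>i<n. (-1) ^ i) * vdm n y"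
  proof (induction n)
    case (Suc n)
    have "(\<Prod>k<n. y (Suc n) - y (Suc k)) = (\<Prod>k<n. (-1) * (y (Suc k) - y (Suc n)))"
      by (rule prod.cong) auto
    also have "\<dots> = (-1) ^ n * (\<Prod>k<n. y (Suc k) - y (Suc n))"
      by (subst prod.distrib) simp
    finally show ?case
      using Suc by (simp add: vdm_Suc ac_simps)
  qed simp
  finally have "vdm n y dvd Determinant.det ?L" by simp
  moreover have "mat n n (\<lambda>(i, j). poly (p j) (y (Suc i))) = ?L * ?Q"
  proof (rule eq_matI)
    fix i j assume "i < dim_row (?L * ?Q)" "j < dim_col (?L * ?Q)"
    then have i: "i < n" and j: "j < n" by auto
    then have "poly (p j) (y (Suc i)) = (\<Sum>m<n. (\<Prod>k<m. y (Suc i) - y (Suc k)) * poly (newton_rest ?y (p j) m) (y (Suc m)))"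
      by (subst poly_newton [of _ _ ?y n]) (simp add: zero)
    then show "mat n n (\<lambda>(i, j). poly (p j) (y (Suc i))) $$ (i, j) = (?L * ?Q) $$ (i, j)"
      using i j by (simp add: scalar_prod_def lessThan_atLeast0)
  qed auto
  ultimately show ?thesis
    using det_mult [of ?L n ?Q] by simp
qed

section \<open>The Cauchy--Binet formula, indexed by partitions\<close>

text \<open>The exponents \<alpha> of the overview, with columns numbered from 0. They decrease
  strictly and encode a partition as an \<open>n\<close>-element set.\<close>

definition shifted_part :: "nat list \<Rightarrow> nat \<Rightarrow> nat \<Rightarrow> nat" where
  "shifted_part lam n j = part lam (Suc j) + n - Suc j"

text \<open>For positive \<open>n\<close> the last condition says that the largest exponent, which
  is the first one, is less than \<open>M\<close>.\<close>

definition bounded_partitions :: "nat \<Rightarrow> nat \<Rightarrow> nat list set" where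
  "bounded_partitions n M = {lam \<in> partitions. length lam \<le> n \<and> part lam 1 + n \<le> M}"

lemma part_antimono:
  assumes "lam \<in> partitions" "i \<le> j"
  shows "part lam (Suc j) \<le> part lam (Suc i)"
proof (cases "i < j \<and> j < length lam")
  case True
  then show ?thesis
    using assms sorted_wrt_nth_less [of "(\<ge>)" lam i j] by (simp add: partitions_def part_def)
qed (use assms in \<open>auto simp: part_def\<close>)

lemma shifted_part_less:
  assumes "lam \<in> partitions" "i < j" "j < n"
  shows "shifted_part lam n j < shifted_part lam n i"
  using part_antimono [of lam i j] assms by (simp add: shifted_part_def)

lemma inj_on_shifted_part: "lam \<in> partitions \<Longrightarrow> inj_on (shifted_part lam n) {0..<n}"
  by (rule inj_onI) (metis atLeastLessThan_iff less_irrefl linorder_neqE_nat shifted_part_less)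

lemma partition_eqI:
  assumes "lam \<in> partitions" "mu \<in> partitions" "length lam \<le> n" "length mu \<le> n"
    and "\<And>j. j < n \<Longrightarrow> part lam (Suc j) = part mu (Suc j)"
  shows "lam = mu"
proof -
  have *: "lam = filter (\<lambda>k. k \<noteq> 0) (map (\<lambda>j. part lam (Suc j)) [0..<n])"
    if "lam \<in> partitions" "length lam \<le> n" for lam
  proof -
    have "map (\<lambda>j. part lam (Suc j)) [0..<n] = lam @ replicate (n - length lam) 0"
      by (rule nth_equalityI) (use that in \<open>auto simp: part_def nth_append\<close>)
    moreover have "filter (\<lambda>k. k \<noteq> 0) lam = lam"
      using that by (intro filter_True) (auto simp: partitions_def intro!: gr0I)
    ultimately show ?thesis by simp
  qed
  have "map (\<lambda>j. part lam (Suc j)) [0..<n] = map (\<lambda>j. part mu (Suc j)) [0..<n]"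
    using assms(5) by simp
  then show ?thesis
    by (subst * [OF assms(1,3)], subst * [OF assms(2,4)]) (rule arg_cong)
qed

lemma sorted_desc_eq_filter_append:
  "sorted_wrt (\<ge>) xs \<Longrightarrow> xs = filter (\<lambda>k. k \<noteq> (0::nat)) xs @ replicate (length xs - length (filter (\<lambda>k. k \<noteq> 0) xs)) 0"
proof (induction xs)
  case (Cons x xs)
  show ?case
  proof (cases "x = 0")
    case True
    then have "set (x # xs) \<subseteq> {0}" using Cons.prems by auto
    then have "x # xs = replicate (length (x # xs)) 0" "filter (\<lambda>k. k \<noteq> 0) (x # xs) = []"
      by (intro replicate_eqI, auto simp: filter_empty_conv)
    then show ?thesis by simp
  qed (use Cons in auto)
qed simp

text \<open>A set is the image of a unique strictly decreasing enumeration, which gives injectivity.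
  Conversely, subtracting the staircase n - 1, ..., 1, 0 from the decreasing enumeration of
  \<open>S\<close> and dropping zeros yields the partition.\<close>

lemma bij_betw_shifted_part:
  "bij_betw (\<lambda>lam. shifted_part lam n ` {0..<n}) (bounded_partitions n M) {S. S \<subseteq> {..<M} \<and> card S = n}"
proof (rule bij_betw_imageI)
  let ?xs = "\<lambda>lam. map (shifted_part lam n) [0..<n]"
  show "inj_on (\<lambda>lam. shifted_part lam n ` {0..<n}) (bounded_partitions n M)"
  proof (rule inj_onI)
    fix lam mu
    assume lam: "lam \<in> bounded_partitions n M" and mu: "mu \<in> bounded_partitions n M"
      and eq: "shifted_part lam n ` {0..<n} = shifted_part mu n ` {0..<n}"
    have sorted: "sorted_wrt (<) (rev (?xs lam))" if "lam \<in> bounded_partitions n M" for lam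
      unfolding sorted_wrt_rev sorted_wrt_map
      using that shifted_part_less [of lam _ _ n]
      by (auto simp: sorted_wrt_iff_nth_less bounded_partitions_def)
    have "rev (?xs lam) = rev (?xs mu)"
      by (rule strict_sorted_equal) (use lam mu sorted eq in auto)
    then have "shifted_part lam n j = shifted_part mu n j" if "j < n" for j
      using that by simp
    then have "part lam (Suc j) = part mu (Suc j)" if "j < n" for j
      using that by (fastforce simp: shifted_part_def)
    then show "lam = mu"
      using lam mu by (intro partition_eqI) (auto simp: bounded_partitions_def)
  qed
  have "S \<in> (\<lambda>lam. shifted_part lam n ` {0..<n}) ` bounded_partitions n M"
    if S: "S \<subseteq> {..<M}" "card S = n" for S
  proof -
    have "finite S" using S finite_subset by blast
    define xs where "xs = rev (sorted_list_of_set S)"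
    have len: "length xs = n" and set: "set xs = S"
      using S \<open>finite S\<close> by (simp_all add: xs_def)
    have desc: "xs ! j < xs ! i" if "i < j" "j < n" for i j
    proof -
      have "sorted_wrt (>) xs" by (simp add: xs_def sorted_wrt_rev)
      then show ?thesis using that len sorted_wrt_nth_less by blast
    qed
    \<comment> \<open>A strictly decreasing list of \<open>n\<close> naturals dominates the
      staircase, so the natural subtraction in \<open>ys\<close> below is exact. The induction runs
      from the right end of the list.\<close>
    have ge: "n \<le> xs ! j + Suc j" if "j < n" for j
    proof -
      have "n \<le> xs ! (n - Suc k) + (n - k)" if "k < n" for k
        using that
      proof (induction k)
        case (Suc k)
        then have "xs ! (n - Suc k) < xs ! (n - Suc (Suc k))"
          by (intro desc) auto
        then show ?case using Suc by linarith
      qed simp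
      from this [of "n - Suc j"] show ?thesis using that by simp
    qed
    define ys where "ys = map (\<lambda>j. xs ! j + Suc j - n) [0..<n]"
    define lam where "lam = filter (\<lambda>k. k \<noteq> 0) ys"
    have gap: "xs ! j + j \<le> xs ! i + i" if "i \<le> j" "j < n" for i j
      using that
    proof (induction j)
      case (Suc j)
      then show ?case
        using desc [of j "Suc j"] by (cases "i = Suc j") auto
    qed simp
    have ys: "sorted_wrt (\<ge>) ys"
      unfolding sorted_wrt_iff_nth_less
    proof (intro allI impI)
      fix i j assume "i < j" "j < length ys"
      then have "i < n" "j < n" by (simp_all add: ys_def)
      then show "ys ! j \<le> ys ! i"
        using gap [of i j] \<open>i < j\<close> by (simp add: ys_def)
    qed
    have "ys = lam @ replicate (length ys - length lam) 0"
      unfolding lam_def by (rule sorted_desc_eq_filter_append [OF ys])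
    then have part: "part lam (Suc j) = ys ! j" if "j < n" for j
      using that arg_cong [of ys _ "\<lambda>l. l ! j"] arg_cong [of ys _ length]
      by (auto simp: part_def nth_append ys_def)
    have shifted: "shifted_part lam n j = xs ! j" if "j < n" for j
      using ge [OF that] that by (simp add: shifted_part_def part ys_def)
    have "lam \<in> partitions"
      using ys by (auto simp: partitions_def lam_def sorted_wrt_filter)
    moreover have "length lam \<le> n"
      using length_filter_le [of _ ys] by (simp add: lam_def ys_def)
    moreover have "part lam 1 + n \<le> M"
    proof (cases "n = 0")
      case True
      then show ?thesis using \<open>length lam \<le> n\<close> by (simp add: part_def)
    next
      case False
      then have "xs ! 0 \<in> S" using len set by (metis gr0I nth_mem)
      then show ?thesis
        using S False ge [of 0] part [of 0] by (auto simp: ys_def)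
    qed
    moreover have "shifted_part lam n ` {0..<n} = S"
      unfolding set [symmetric] using shifted len by (force simp: set_conv_nth)
    ultimately show ?thesis
      by (intro image_eqI [of _ _ lam]) (auto simp: bounded_partitions_def)
  qed
  moreover have "shifted_part lam n ` {0..<n} \<subseteq> {..<M}" if "lam \<in> bounded_partitions n M" for lam
  proof clarify
    fix j assume "j \<in> {0..<n}"
    then show "shifted_part lam n j < M"
      using that part_antimono [of lam 0 j] by (auto simp: bounded_partitions_def shifted_part_def)
  qed
  moreover have "card (shifted_part lam n ` {0..<n}) = n" if "lam \<in> bounded_partitions n M" for lam
    using that inj_on_shifted_part [of lam n] by (simp add: bounded_partitions_def card_image)
  ultimately show "(\<lambda>lam. shifted_part lam n ` {0..<n}) ` bounded_partitions n M =
      {S. S \<subseteq> {..<M} \<and> card S = n}"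
    by (auto simp: image_subset_iff)
qed

lemma finite_bounded_partitions: "finite (bounded_partitions n M)"
proof -
  have "finite {S. S \<subseteq> {..<M} \<and> card S = n}"
    by (rule finite_subset [of _ "Pow {..<M}"]) auto
  then show ?thesis
    using bij_betw_finite [OF bij_betw_shifted_part] by blast
qed

text \<open>Describes one block of the Cauchy-Binet sum: injective index functions with a prescribed
  image differ by a permutation of the positions. The restriction makes them extensional, as
  membership in the function space requires.\<close>

lemma bij_betw_permutations_same_image:
  assumes inj: "inj_on \<alpha> {0..<n::nat}" and img: "\<alpha> ` {0..<n} \<subseteq> {..<M::nat}"
  shows "bij_betw (\<lambda>\<sigma>. \<lambda>i\<in>{0..<n}. \<alpha> (\<sigma> i)) {\<sigma>. \<sigma> permutes {0..<n}}
           {c \<in> {0..<n} \<rightarrow>\<^sub>E {..<M}. inj_on c {0..<n} \<and> c ` {0..<n} = \<alpha> ` {0..<n}}"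
proof (rule bij_betw_imageI)
  let ?N = "{0..<n}"
  show "inj_on (\<lambda>\<sigma>. \<lambda>i\<in>?N. \<alpha> (\<sigma> i)) {\<sigma>. \<sigma> permutes ?N}"
  proof (rule inj_onI)
    fix \<sigma> \<tau>
    assume p: "\<sigma> \<in> {\<sigma>. \<sigma> permutes ?N}" "\<tau> \<in> {\<sigma>. \<sigma> permutes ?N}"
      and eq: "(\<lambda>i\<in>?N. \<alpha> (\<sigma> i)) = (\<lambda>i\<in>?N. \<alpha> (\<tau> i))"
    have "\<sigma> i = \<tau> i" for i
    proof (cases "i \<in> ?N")
      case True
      then have "\<alpha> (\<sigma> i) = \<alpha> (\<tau> i)" using fun_cong [OF eq, of i] by simp
      moreover have "\<sigma> i \<in> ?N" "\<tau> i \<in> ?N" 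
        using p True permutes_in_image [of _ ?N i] by auto
      ultimately show ?thesis by (rule inj_onD [OF inj])
    qed (use p in \<open>simp add: permutes_not_in\<close>)
    then show "\<sigma> = \<tau>" by blast
  qed
  have surj: "c \<in> (\<lambda>\<sigma>. \<lambda>i\<in>?N. \<alpha> (\<sigma> i)) ` {\<sigma>. \<sigma> permutes ?N}"
    if c: "c \<in> ?N \<rightarrow>\<^sub>E {..<M}" "inj_on c ?N" "c ` ?N = \<alpha> ` ?N" for c
  proof -
    define \<sigma> where "\<sigma> i = (if i \<in> ?N then the_inv_into ?N \<alpha> (c i) else i)" for i
    have in_img: "c i \<in> \<alpha> ` ?N" if "i \<in> ?N" for i
      using that c(3) by blast
    have \<alpha>\<sigma>: "\<alpha> (\<sigma> i) = c i" if "i \<in> ?N" for i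
      using that f_the_inv_into_f [OF inj in_img] by (simp add: \<sigma>_def)
    have "bij_betw \<sigma> ?N ?N"
    proof (rule bij_betw_imageI)
      show inj\<sigma>: "inj_on \<sigma> ?N"
        by (rule inj_onI) (metis \<alpha>\<sigma> c(2) inj_onD)
      have "\<sigma> ` ?N \<subseteq> ?N"
        using the_inv_into_into [OF inj in_img subset_refl] by (auto simp: \<sigma>_def)
      then show "\<sigma> ` ?N = ?N"
        by (simp add: endo_inj_surj inj\<sigma>)
    qed
    then have "\<sigma> permutes ?N"
      by (rule bij_imp_permutes) (simp add: \<sigma>_def)
    moreover have "c = (\<lambda>i\<in>?N. \<alpha> (\<sigma> i))"
      by (rule extensionalityI [of _ ?N]) (use c \<alpha>\<sigma> in \<open>auto simp: PiE_def\<close>)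
    ultimately show ?thesis by blast
  qed
  have into: "(\<lambda>i\<in>?N. \<alpha> (\<sigma> i)) \<in> ?N \<rightarrow>\<^sub>E {..<M}" "inj_on (\<lambda>i\<in>?N. \<alpha> (\<sigma> i)) ?N"
    "(\<lambda>i\<in>?N. \<alpha> (\<sigma> i)) ` ?N = \<alpha> ` ?N"
    if p: "\<sigma> permutes ?N" for \<sigma>
  proof -
    have N: "\<sigma> ` ?N = ?N" using p by (rule permutes_image)
    show img': "(\<lambda>i\<in>?N. \<alpha> (\<sigma> i)) ` ?N = \<alpha> ` ?N"
    proof -
      have "(\<lambda>i\<in>?N. \<alpha> (\<sigma> i)) ` ?N = \<alpha> ` \<sigma> ` ?N"
        unfolding image_image by (rule image_cong) auto
      then show ?thesis by (simp add: N)
    qed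
    show "(\<lambda>i\<in>?N. \<alpha> (\<sigma> i)) \<in> ?N \<rightarrow>\<^sub>E {..<M}"
      using img img' by auto
    show "inj_on (\<lambda>i\<in>?N. \<alpha> (\<sigma> i)) ?N"
      using comp_inj_on [of \<sigma> ?N \<alpha>] inj N permutes_inj_on [OF p] by (simp add: comp_def)
  qed
  show "(\<lambda>\<sigma>. \<lambda>i\<in>?N. \<alpha> (\<sigma> i)) ` {\<sigma>. \<sigma> permutes ?N} =
      {c \<in> ?N \<rightarrow>\<^sub>E {..<M}. inj_on c ?N \<and> c ` ?N = \<alpha> ` ?N}" (is "?A = ?B")
  proof (intro equalityI image_subsetI subsetI)
    fix \<sigma> assume "\<sigma> \<in> {\<sigma>. \<sigma> permutes ?N}"
    then have p: "\<sigma> permutes ?N" by simp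
    show "(\<lambda>i\<in>?N. \<alpha> (\<sigma> i)) \<in> ?B"
      by (intro CollectI conjI into p)
  next
    fix c assume "c \<in> ?B"
    then show "c \<in> ?A" by (intro surj) auto
  qed
qed

text \<open>Multilinearity expands the determinant over index functions \<open>c\<close>. Those that
  are not injective produce two equal rows; the others are grouped by image, and within a group the
  sign of the row permutation assembles the determinant of \<open>A\<close>.\<close>

lemma cauchy_binet_partitions:
  fixes A B :: "nat \<Rightarrow> nat \<Rightarrow> 'a::comm_ring_1"
  shows "Determinant.det (mat n n (\<lambda>(i, j). \<Sum>\<alpha><M. A i \<alpha> * B j \<alpha>)) =
    (\<Sum>lam\<in>bounded_partitions n M.
       Determinant.det (mat n n (\<lambda>(i, j). A i (shifted_part lam n j))) *
       Determinant.det (mat n n (\<lambda>(i, j). B i (shifted_part lam n j))))"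
proof -
  let ?N = "{0..<n}" and ?E = "{0..<n} \<rightarrow>\<^sub>E {..<M}"
  let ?I = "{c \<in> ?E. inj_on c ?N}"
  define G where "G c = (\<Prod>i = 0..<n. A i (c i)) * Determinant.det (mat n n (\<lambda>(i, j). B j (c i)))" for c
  have "Determinant.det (mat n n (\<lambda>(i, j). \<Sum>\<alpha><M. A i \<alpha> * B j \<alpha>)) =
      (\<Sum>p | p permutes ?N. signof p * (\<Sum>c\<in>?E. \<Prod>i = 0..<n. A i (c i) * B (p i) (c i)))"
    by (simp add: det_mat_eq_sum prod_sum_PiE)
  also have "\<dots> = (\<Sum>c\<in>?E. G c)"
  proof -
    have "(\<Sum>p | p permutes ?N. signof p * (\<Sum>c\<in>?E. \<Prod>i = 0..<n. A i (c i) * B (p i) (c i))) =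
        (\<Sum>c\<in>?E. \<Sum>p | p permutes ?N. signof p * (\<Prod>i = 0..<n. A i (c i) * B (p i) (c i)))"
      unfolding sum_distrib_left by (rule sum.swap)
    also have "\<dots> = (\<Sum>c\<in>?E. G c)"
      unfolding G_def det_mat_eq_sum sum_distrib_left prod.distrib
      by (intro sum.cong refl mult.left_commute)
    finally show ?thesis .
  qed
  also have "\<dots> = (\<Sum>c\<in>?I. G c)"
  proof (rule sum.mono_neutral_right)
    show "\<forall>c\<in>?E - ?I. G c = 0"
    proof
      fix c assume "c \<in> ?E - ?I"
      then have "\<not> inj_on c ?N" by blast
      then obtain i j where ij: "i < n" "j < n" "i \<noteq> j" "c i = c j"
        unfolding inj_on_def by auto
      then have "Determinant.det (mat n n (\<lambda>(i, j). B j (c i))) = 0"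
        by (intro det_identical_rows [of _ n i j]) auto
      then show "G c = 0" by (simp add: G_def)
    qed
  qed (auto simp: finite_PiE)
  also have "\<dots> = (\<Sum>S | S \<subseteq> {..<M} \<and> card S = n. \<Sum>c\<in>{c \<in> ?I. c ` ?N = S}. G c)"
  proof (rule sum.group [symmetric])
    show "finite ?I"
      by (rule finite_subset [of _ ?E]) (auto simp: finite_PiE)
    show "finite {S. S \<subseteq> {..<M} \<and> card S = n}"
      by (rule finite_subset [of _ "Pow {..<M}"]) auto
    show "(\<lambda>c. c ` ?N) ` ?I \<subseteq> {S. S \<subseteq> {..<M} \<and> card S = n}"
      by (auto simp: card_image PiE_iff)
  qed
  also have "\<dots> = (\<Sum>lam\<in>bounded_partitions n M. \<Sum>c\<in>{c \<in> ?I. c ` ?N = shifted_part lam n ` ?N}. G c)"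
    by (rule sum.reindex_bij_betw [OF bij_betw_shifted_part, symmetric])
  also have "\<dots> = (\<Sum>lam\<in>bounded_partitions n M.
       Determinant.det (mat n n (\<lambda>(i, j). A i (shifted_part lam n j))) *
       Determinant.det (mat n n (\<lambda>(i, j). B i (shifted_part lam n j))))"
  proof (rule sum.cong [OF refl])
    fix lam assume lam: "lam \<in> bounded_partitions n M"
    let ?\<alpha> = "shifted_part lam n"
    have img: "?\<alpha> ` ?N \<subseteq> {..<M}"
      using bij_betwE [OF bij_betw_shifted_part] lam by fast
    have inj: "inj_on ?\<alpha> ?N"
      using lam by (auto simp: bounded_partitions_def intro: inj_on_shifted_part)
    let ?B = "mat n n (\<lambda>(i, j). B j (?\<alpha> i))"
    have "(\<Sum>c\<in>{c \<in> ?I. c ` ?N = ?\<alpha> ` ?N}. G c) = (\<Sum>\<sigma> | \<sigma> permutes ?N. G (\<lambda>i\<in>?N. ?\<alpha> (\<sigma> i)))"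
      using sum.reindex_bij_betw [OF bij_betw_permutations_same_image [OF inj img], of G]
      by (simp add: conj_assoc)
    also have "\<dots> = (\<Sum>\<sigma> | \<sigma> permutes ?N. (\<Prod>i = 0..<n. A i (?\<alpha> (\<sigma> i))) * (signof \<sigma> * Determinant.det ?B))"
    proof (rule sum.cong [OF refl])
      fix \<sigma> assume "\<sigma> \<in> {\<sigma>. \<sigma> permutes ?N}"
      then have p: "\<sigma> permutes ?N" by simp
      have "mat n n (\<lambda>(i, j). B j ((\<lambda>i\<in>?N. ?\<alpha> (\<sigma> i)) i)) = mat n n (\<lambda>(i, j). ?B $$ (\<sigma> i, j))"
        by (rule eq_matI) (use p permutes_in_image [OF p] in auto)
      then show "G (\<lambda>i\<in>?N. ?\<alpha> (\<sigma> i)) = (\<Prod>i = 0..<n. A i (?\<alpha> (\<sigma> i))) * (signof \<sigma> * Determinant.det ?B)"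
        using det_permute_rows [OF _ p, of ?B] by (simp add: G_def)
    qed
    also have "\<dots> = Determinant.det (mat n n (\<lambda>(i, j). A i (?\<alpha> j))) * Determinant.det ?B"
      unfolding det_mat_eq_sum [of n "\<lambda>i j. A i (?\<alpha> j)"] sum_distrib_right
      by (intro sum.cong refl) (simp only: ac_simps)
    also have "Determinant.det ?B = Determinant.det (mat n n (\<lambda>(i, j). B i (?\<alpha> j)))"
      by (subst det_transpose [of _ n, symmetric]) (auto intro!: arg_cong [where f = Determinant.det])
    finally show "(\<Sum>c\<in>{c \<in> ?I. c ` ?N = ?\<alpha> ` ?N}. G c) =
      Determinant.det (mat n n (\<lambda>(i, j). A i (?\<alpha> j))) * Determinant.det (mat n n (\<lambda>(i, j). B i (?\<alpha> j)))" .
  qed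
  finally show ?thesis .
qed

section \<open>Coefficients of formal power series\<close>

lemma coeff_0 [simp]: "mfps_coeff 0 m = 0"
  by (simp add: zero_mfps_def)

lemma coeff_1: "mfps_coeff 1 m = (if m = 0 then 1 else 0)"
  by (simp add: one_mfps_def)

lemma coeff_add [simp]: "mfps_coeff (f + g) m = mfps_coeff f m + mfps_coeff g m"
  by (simp add: plus_mfps_def)

lemma coeff_diff [simp]: "mfps_coeff (f - g) m = mfps_coeff f m - mfps_coeff g m"
  by (simp add: minus_mfps_def)

lemma coeff_times: "mfps_coeff (f * g) m = (\<Sum>(p, q) | p + q = m. mfps_coeff f p * mfps_coeff g q)"
  by (simp add: times_mfps_def)

lemma coeff_sum: "mfps_coeff (sum f S) m = (\<Sum>s\<in>S. mfps_coeff (f s) m)"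
  by (induction S rule: infinite_finite_induct) auto

lemma coeff_const: "mfps_coeff (mfps_const c) m = (if m = 0 then c else 0)"
  by (simp add: mfps_const_def)

lemma coeff_var: "mfps_coeff (mfps_var j) m = (if m = Poly_Mapping.single j 1 then 1 else 0)"
  by (simp add: mfps_var_def)

lemma coeff_map [simp]: "mfps_coeff (mfps_map h f) m = h (mfps_coeff f m)"
  by (simp add: mfps_map_def)

lemma coeff_truncate:
  "mfps_coeff (mfps_truncate n f) m = (if Poly_Mapping.keys m \<subseteq> {..n} then mfps_coeff f m else 0)"
  by (simp add: mfps_truncate_def)

lemma coeff_const_times [simp]: "mfps_coeff (mfps_const c * f) m = c * mfps_coeff f m"
proof -
  have "mfps_coeff (mfps_const c * f) m =
      (\<Sum>u\<in>{(p, q). p + q = m}. if u = (0, m) then c * mfps_coeff f m else 0)"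
    unfolding coeff_times by (rule sum.cong) (auto simp: coeff_const split: if_splits)
  then show ?thesis
    by (simp add: finite_monom_splits)
qed

lemma coeff_var_times_add:
  "mfps_coeff (mfps_var j * f) (Poly_Mapping.single j 1 + m) = mfps_coeff f m"
proof -
  have "mfps_coeff (mfps_var j * f) (Poly_Mapping.single j 1 + m) =
      (\<Sum>u\<in>{(p, q). p + q = Poly_Mapping.single j 1 + m}.
         if u = (Poly_Mapping.single j 1, m) then mfps_coeff f m else 0)"
    unfolding coeff_times by (rule sum.cong) (auto simp: coeff_var split: if_splits)
  then show ?thesis
    by (simp add: finite_monom_splits)
qed

lemma coeff_var_times_0:
  assumes "Poly_Mapping.lookup m j = 0"
  shows "mfps_coeff (mfps_var j * f) m = 0"
  unfolding coeff_times
proof (rule sum.neutral, clarify)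
  fix p q assume "m = p + q"
  then have "p \<noteq> Poly_Mapping.single j 1"
    using assms by (auto simp: lookup_add)
  then show "mfps_coeff (mfps_var j) p * mfps_coeff f q = 0"
    by (simp add: coeff_var)
qed

lemma monom_split:
  assumes "Poly_Mapping.lookup m j \<noteq> (0::nat)"
  obtains m' where "m = Poly_Mapping.single j 1 + m'"
proof
  show "m = Poly_Mapping.single j 1 + (m - Poly_Mapping.single j 1)"
    using assms by (intro poly_mapping_eqI) (auto simp: lookup_add lookup_minus lookup_single when_def)
qed

lemma keys_monom_add: "Poly_Mapping.keys (p + q :: 'v \<Rightarrow>\<^sub>0 nat) = Poly_Mapping.keys p \<union> Poly_Mapping.keys q"
  by (auto simp: in_keys_iff lookup_add)

lemma monom_degree_superset:
  assumes "finite S" "Poly_Mapping.keys m \<subseteq> S"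
  shows "monom_degree m = (\<Sum>v\<in>S. Poly_Mapping.lookup m v)"
  unfolding monom_degree_def using assms by (intro sum.mono_neutral_left) (auto simp: in_keys_iff)

lemma monom_degree_add [simp]: "monom_degree (p + q) = monom_degree p + monom_degree q"
proof -
  let ?S = "Poly_Mapping.keys p \<union> Poly_Mapping.keys q"
  have "monom_degree (p + q) = (\<Sum>v\<in>?S. Poly_Mapping.lookup (p + q) v)"
    by (rule monom_degree_superset) (auto simp: keys_monom_add)
  then show ?thesis
    by (simp add: lookup_add sum.distrib flip: monom_degree_superset)
qed

lemma monom_degree_single [simp]: "monom_degree (Poly_Mapping.single v k) = k"
  by (simp add: monom_degree_def)

lemma monom_degree_0 [simp]: "monom_degree 0 = 0"
  by (simp add: monom_degree_def)

section \<open>Ring homomorphisms\<close>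

lemma comm_ring_homI:
  assumes "h 1 = 1" "\<And>x y. h (x + y) = h x + h y" "\<And>x y. h (x * y) = h x * h y"
  shows "comm_ring_hom (h :: 'a::comm_ring_1 \<Rightarrow> 'b::comm_ring_1)"
proof -
  have "h 0 + h 0 = h 0 + 0" using assms(2) [of 0 0] by simp
  then have "h 0 = 0" by (simp only: add_left_cancel)
  then show ?thesis using assms by unfold_locales auto
qed

lemma comm_ring_hom_mfps_const: "comm_ring_hom mfps_const"
  by (rule comm_ring_homI) (rule mfps_eqI, simp add: coeff_const coeff_1)+

lemma comm_ring_hom_mfps_map:
  assumes "comm_ring_hom h"
  shows "comm_ring_hom (mfps_map h)"
proof -
  interpret h: comm_ring_hom h by fact
  show ?thesis
    by (rule comm_ring_homI; rule mfps_eqI)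
       (auto simp: coeff_1 coeff_times h.hom_add h.hom_mult h.hom_sum case_prod_beta)
qed

lemma comm_ring_hom_mfps_truncate: "comm_ring_hom (mfps_truncate n :: 'a::comm_ring_1 mfps \<Rightarrow> _)"
proof (rule comm_ring_homI; rule mfps_eqI)
  fix f g :: "'a mfps" and m
  show "mfps_coeff (mfps_truncate n (f * g)) m = mfps_coeff (mfps_truncate n f * mfps_truncate n g) m"
  proof (cases "Poly_Mapping.keys m \<subseteq> {..n}")
    case True
    then show ?thesis
      by (auto simp: coeff_truncate coeff_times keys_monom_add intro!: sum.cong)
  next
    case False
    then have "mfps_coeff (mfps_truncate n f * mfps_truncate n g) m = 0"
      unfolding coeff_times by (intro sum.neutral) (auto simp: coeff_truncate keys_monom_add)
    with False show ?thesis by (simp add: coeff_truncate)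
  qed
qed (auto simp: coeff_truncate coeff_1)

interpretation mfps_const: comm_ring_hom mfps_const
  by (rule comm_ring_hom_mfps_const)

interpretation mfps_truncate: comm_ring_hom "mfps_truncate n"
  by (rule comm_ring_hom_mfps_truncate)

lemma mfps_map_const: "h 0 = 0 \<Longrightarrow> mfps_map h (mfps_const c) = mfps_const (h c)"
  by (rule mfps_eqI) (simp add: coeff_const)

lemma mfps_map_var: "h 0 = 0 \<Longrightarrow> h 1 = 1 \<Longrightarrow> mfps_map h (mfps_var j) = mfps_var j"
  by (rule mfps_eqI) (simp add: coeff_var)

lemma mfps_map_truncate: "h 0 = 0 \<Longrightarrow> mfps_map h (mfps_truncate n f) = mfps_truncate n (mfps_map h f)"
  by (rule mfps_eqI) (simp add: coeff_truncate)

lemma mfps_truncate_const [simp]: "mfps_truncate n (mfps_const c) = mfps_const c"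
  by (rule mfps_eqI) (simp add: coeff_truncate coeff_const)

lemma mfps_truncate_var: "mfps_truncate n (mfps_var j) = (if j \<le> n then mfps_var j else 0)"
  by (rule mfps_eqI) (auto simp: coeff_truncate coeff_var)

section \<open>Geometric series and exact quotients\<close>

text \<open>The expansion of 1 / (1 - c y_j); the test on \<open>m\<close> selects the monomials in
  which no variable other than y_j occurs.\<close>

definition mfps_geometric :: "'r::comm_ring_1 \<Rightarrow> nat \<Rightarrow> 'r mfps" where
  "mfps_geometric c j = Abs_mfps (\<lambda>m. if m = Poly_Mapping.single j (Poly_Mapping.lookup m j)
     then c ^ Poly_Mapping.lookup m j else 0)"

lemma mfps_geometric_inverse: "mfps_geometric c j * (1 - mfps_const c * mfps_var j) = 1"
proof (rule mfps_eqI)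
  fix m
  let ?G = "mfps_geometric c j"
  have eq: "?G * (1 - mfps_const c * mfps_var j) = ?G - mfps_const c * (mfps_var j * ?G)"
    by (simp add: algebra_simps)
  show "mfps_coeff (?G * (1 - mfps_const c * mfps_var j)) m = mfps_coeff 1 m"
  proof (cases "Poly_Mapping.lookup m j = 0")
    case True
    then show ?thesis
      unfolding eq by (simp add: coeff_var_times_0 coeff_1) (auto simp: mfps_geometric_def)
  next
    case False
    then obtain m' where m: "m = Poly_Mapping.single j 1 + m'"
      by (rule monom_split)
    have "m \<noteq> 0" using False by auto
    have "(m = Poly_Mapping.single j (Poly_Mapping.lookup m j)) \<longleftrightarrow>
        m' = Poly_Mapping.single j (Poly_Mapping.lookup m' j)"
      using single_add [of j 1 "Poly_Mapping.lookup m' j"] by (simp add: m lookup_add)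
    then have "mfps_coeff ?G m = c * mfps_coeff ?G m'"
      by (simp add: mfps_geometric_def) (simp add: m lookup_add)
    then show ?thesis
      using \<open>m \<noteq> 0\<close> coeff_var_times_add [of j ?G m'] unfolding eq by (simp add: coeff_1 m)
  qed
qed

lemma inverse_unique:
  fixes u v w :: "'a::comm_ring_1"
  assumes "u * w = 1" "v * w = 1"
  shows "u = v"
  by (metis assms mult.assoc mult.commute mult_1)

text \<open>Homomorphisms preserve inverses and inverses are unique, so the coefficients need not be
  compared.\<close>

lemma mfps_geometric_hom:
  assumes "comm_ring_hom h"
  shows "mfps_map h (mfps_geometric c j) = mfps_geometric (h c) j"
proof -
  interpret h: comm_ring_hom h by fact
  interpret m: comm_ring_hom "mfps_map h" by (rule comm_ring_hom_mfps_map) fact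
  have "mfps_map h (mfps_geometric c j) * (1 - mfps_const (h c) * mfps_var j) = 1"
    using arg_cong [OF mfps_geometric_inverse [of c j], of "mfps_map h"]
    by (simp add: m.hom_mult m.hom_minus mfps_map_const mfps_map_var)
  then show ?thesis
    using inverse_unique mfps_geometric_inverse by blast
qed

lemma mfps_truncate_geometric:
  "mfps_truncate n (mfps_geometric c j) = (if j \<le> n then mfps_geometric c j else 1)"
proof -
  have trunc: "mfps_truncate n (mfps_geometric c j) * (1 - mfps_const c * mfps_truncate n (mfps_var j)) = 1"
    using arg_cong [OF mfps_geometric_inverse [of c j], of "mfps_truncate n"]
    by (simp add: mfps_truncate.hom_mult mfps_truncate.hom_minus)
  show ?thesis
  proof (cases "j \<le> n")
    case True
    with trunc have "mfps_truncate n (mfps_geometric c j) * (1 - mfps_const c * mfps_var j) = 1"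
      by (simp add: mfps_truncate_var)
    then have "mfps_truncate n (mfps_geometric c j) = mfps_geometric c j"
      by (rule inverse_unique) (rule mfps_geometric_inverse)
    with True show ?thesis by simp
  qed (use trunc in \<open>simp add: mfps_truncate_var\<close>)
qed

lemma exact_quot_eqI:
  assumes "r * q = p" "\<And>s. s * q = 0 \<Longrightarrow> s = 0"
  shows "exact_quot p q = r"
  unfolding exact_quot_def
proof (rule the_equality)
  fix s assume "s * q = p"
  then have "(s - r) * q = 0" using assms(1) by (simp add: algebra_simps)
  then have "s - r = 0" by (rule assms(2))
  then show "s = r" by simp
qed (rule assms(1))

lemma exact_quot_unit:
  assumes "v * q = 1"
  shows "exact_quot p q = p * v"
proof (rule exact_quot_eqI)
  show "p * v * q = p" using assms by (simp add: mult.assoc)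
  show "s = 0" if "s * q = 0" for s
    using assms that by (metis mult.assoc mult.commute mult_1 mult_zero_left)
qed

section \<open>Topology and compatible sequences of truncations\<close>

text \<open>A basic neighbourhood constrains only finitely many coefficients, so it suffices that
  each single coefficient is eventually constant.\<close>

lemma tendsto_mfps:
  assumes "\<And>m. eventually (\<lambda>x. mfps_coeff (f x) m = mfps_coeff L m) F"
  shows "(f \<longlongrightarrow> L) F"
proof (rule topological_tendstoI)
  fix S assume "open S" "L \<in> S"
  then obtain M where "finite M" and M: "{g. \<forall>m\<in>M. mfps_coeff g m = mfps_coeff L m} \<subseteq> S"
    unfolding open_mfps_def by blast
  have "eventually (\<lambda>x. \<forall>m\<in>M. mfps_coeff (f x) m = mfps_coeff L m) F"
    using \<open>finite M\<close> assms by (simp add: eventually_ball_finite)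
  then show "eventually (\<lambda>x. f x \<in> S) F"
    by (rule eventually_mono) (use M in auto)
qed

lemma finite_keys_bounded: "\<exists>t. Poly_Mapping.keys (m :: nat \<Rightarrow>\<^sub>0 nat) \<subseteq> {..t}"
  using finite_nat_set_iff_bounded_le [of "Poly_Mapping.keys m"] by auto

lemma mfps_truncate_eqI:
  assumes "\<And>n. mfps_truncate n f = mfps_truncate n g"
  shows "f = g"
proof (rule mfps_eqI)
  fix m :: "nat \<Rightarrow>\<^sub>0 nat"
  obtain t where "Poly_Mapping.keys m \<subseteq> {..t}" using finite_keys_bounded [of m] by blast
  then show "mfps_coeff f m = mfps_coeff g m"
    using arg_cong [OF assms [of t], of "\<lambda>f. mfps_coeff f m"] by (simp add: coeff_truncate)
qed

lemma truncate_compatible_le: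
  assumes compat: "\<And>n. mfps_truncate n (F (Suc n)) = F n" and "s \<le> t"
  shows "mfps_truncate s (F t) = F s"
  using \<open>s \<le> t\<close>
proof (induction t rule: dec_induct)
  case base
  show ?case
  proof (rule mfps_eqI)
    fix m
    \<comment> \<open>By compatibility \<open>F s\<close> is itself a truncation at level
      \<open>s\<close>, hence unchanged by truncating there again.\<close>
    have "mfps_coeff (F s) m = mfps_coeff (mfps_truncate s (F (Suc s))) m" by (simp add: compat)
    then show "mfps_coeff (mfps_truncate s (F s)) m = mfps_coeff (F s) m"
      by (simp add: coeff_truncate)
  qed
next
  case (step t)
  have "mfps_truncate s (F (Suc t)) = mfps_truncate s (mfps_truncate t (F (Suc t)))"
  proof (rule mfps_eqI)
    fix m
    show "mfps_coeff (mfps_truncate s (F (Suc t))) m =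
        mfps_coeff (mfps_truncate s (mfps_truncate t (F (Suc t)))) m"
      using order_trans [of "Poly_Mapping.keys m" "{..s}" "{..t}"] \<open>s \<le> t\<close>
      by (simp add: coeff_truncate)
  qed
  then show ?case using step compat by simp
qed

text \<open>The coefficient of \<open>m\<close> is read off at a chosen level \<open>b m\<close>
  containing all variables of \<open>m\<close>; compatibility makes the choice immaterial. Both the
  dual Schur functions and the Cauchy kernel arise as such limits.\<close>

lemma ex_limit_of_truncations:
  assumes compat: "\<And>n. mfps_truncate n (F (Suc n)) = F n"
  obtains G where "\<And>n. mfps_truncate n G = F n"
proof
  define b where "b m = (SOME t. Poly_Mapping.keys m \<subseteq> {..t})" for m :: "nat \<Rightarrow>\<^sub>0 nat"
  have b: "Poly_Mapping.keys m \<subseteq> {..b m}" for m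
    unfolding b_def using finite_keys_bounded by (rule someI_ex)
  have indep: "mfps_coeff (F s) m = mfps_coeff (F t) m"
    if "Poly_Mapping.keys m \<subseteq> {..s}" "Poly_Mapping.keys m \<subseteq> {..t}" for m s t
  proof -
    have le: "mfps_coeff (F s) m = mfps_coeff (F t) m" if "s \<le> t" "Poly_Mapping.keys m \<subseteq> {..s}" for s t
      using truncate_compatible_le [of F s t] that compat
      by (metis coeff_truncate)
    show ?thesis
      by (rule linorder_le_cases [of s t]) (use le [of s t] le [of t s] that in argo)+
  qed
  show "mfps_truncate n (Abs_mfps (\<lambda>m. mfps_coeff (F (b m)) m)) = F n" for n
  proof (rule mfps_eqI)
    fix m
    have "\<not> Poly_Mapping.keys m \<subseteq> {..n} \<Longrightarrow> mfps_coeff (F n) m = 0"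
      by (metis coeff_truncate compat)
    then show "mfps_coeff (mfps_truncate n (Abs_mfps (\<lambda>m. mfps_coeff (F (b m)) m))) m = mfps_coeff (F n) m"
      using indep [of m "b m" n] b by (auto simp: coeff_truncate)
  qed
qed

section \<open>Order of vanishing\<close>

text \<open>Order at least \<open>d\<close> with respect to total degree; this measures the error of
  cutting off sums over exponents.\<close>

definition vanish_below :: "nat \<Rightarrow> 'r::comm_ring_1 mfps \<Rightarrow> bool" where
  "vanish_below d f \<longleftrightarrow> (\<forall>m. monom_degree m < d \<longrightarrow> mfps_coeff f m = 0)"

lemma vanish_below_0 [simp]: "vanish_below d 0"
  by (simp add: vanish_below_def)

lemma vanish_below_add: "vanish_below d f \<Longrightarrow> vanish_below d g \<Longrightarrow> vanish_below d (f + g)"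
  by (simp add: vanish_below_def)

lemma vanish_below_sum: "(\<And>s. s \<in> S \<Longrightarrow> vanish_below d (f s)) \<Longrightarrow> vanish_below d (sum f S)"
  by (simp add: vanish_below_def coeff_sum)

lemma vanish_below_mult_left:
  assumes "vanish_below d f"
  shows "vanish_below d (g * f)"
  unfolding vanish_below_def coeff_times
proof (intro allI impI sum.neutral ballI)
  fix m :: "nat \<Rightarrow>\<^sub>0 nat" and u
  assume "monom_degree m < d" "u \<in> {(p, q). p + q = m}"
  then show "(case u of (p, q) \<Rightarrow> mfps_coeff g p * mfps_coeff f q) = 0"
    using assms by (auto simp: vanish_below_def)
qed

lemma vanish_below_mult_right: "vanish_below d f \<Longrightarrow> vanish_below d (f * g)"
  using vanish_below_mult_left [of d f g] by (simp add: mult.commute)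

lemma vanish_below_var_mult:
  assumes "vanish_below d f"
  shows "vanish_below (Suc d) (mfps_var j * f)"
  unfolding vanish_below_def
proof (intro allI impI)
  fix m :: "nat \<Rightarrow>\<^sub>0 nat"
  assume m: "monom_degree m < Suc d"
  show "mfps_coeff (mfps_var j * f) m = 0"
  proof (cases "Poly_Mapping.lookup m j = 0")
    case False
    then obtain m' where m': "m = Poly_Mapping.single j 1 + m'"
      by (rule monom_split)
    have "monom_degree m = Suc (monom_degree m')"
      by (simp add: m')
    then show ?thesis
      using assms m coeff_var_times_add [of j f m'] by (simp add: m' vanish_below_def)
  qed (rule coeff_var_times_0)
qed

lemma vanish_below_var_power: "vanish_below k (mfps_var j ^ k)"
proof (induction k)
  case (Suc k)
  then show ?case using vanish_below_var_mult by simp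
qed (simp add: vanish_below_def)

lemma vanish_below_prod_diff:
  assumes "\<And>s. s \<in> S \<Longrightarrow> vanish_below d (f s - g s)"
  shows "vanish_below d (prod f S - prod g S)"
  using assms
proof (induction S rule: infinite_finite_induct)
  case (insert s S)
  have "prod f (insert s S) - prod g (insert s S) =
      (f s - g s) * prod f S + g s * (prod f S - prod g S)"
    using insert by (simp add: algebra_simps)
  then show ?case
    using insert by (simp add: vanish_below_add vanish_below_mult_left vanish_below_mult_right)
qed simp_all

text \<open>At the monomial y_j m, the product has the coefficient of \<open>f\<close> at y_j m /
  y_i (or 0) minus that at m. The former monomial has the degree of m but a smaller exponent of y_i,
  whence the induction on that exponent. The coefficient ring may have zero divisors.\<close>

lemma vanish_below_var_diff_cancel:
  assumes "i \<noteq> j" and van: "vanish_below (Suc d) ((mfps_var i - mfps_var j) * f)"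
  shows "vanish_below d f"
proof -
  have "mfps_coeff f m = 0" if "monom_degree m < d" for m :: "nat \<Rightarrow>\<^sub>0 nat"
    using that
  proof (induction "Poly_Mapping.lookup m i" arbitrary: m)
    case 0
    then have "mfps_coeff ((mfps_var i - mfps_var j) * f) (Poly_Mapping.single j 1 + m) = 0"
      using van by (simp add: vanish_below_def)
    then show ?case
      using 0 \<open>i \<noteq> j\<close> coeff_var_times_add [of j f m]
        coeff_var_times_0 [of "Poly_Mapping.single j 1 + m" i f]
      by (simp add: left_diff_distrib lookup_add lookup_single)
  next
    case (Suc k)
    then have "Poly_Mapping.lookup m i \<noteq> 0" by simp
    then obtain m' where m': "m = Poly_Mapping.single i 1 + m'"
      by (rule monom_split)
    have deg: "monom_degree m = Suc (monom_degree m')"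
      by (simp add: m')
    have "mfps_coeff f (Poly_Mapping.single j 1 + m') = 0"
      using Suc \<open>i \<noteq> j\<close> deg by (intro Suc.hyps) (simp_all add: m' lookup_add lookup_single)
    moreover have "mfps_coeff ((mfps_var i - mfps_var j) * f) (Poly_Mapping.single j 1 + m) = 0"
      using van Suc.prems by (simp add: vanish_below_def)
    moreover have "Poly_Mapping.single j 1 + m = Poly_Mapping.single i 1 + (Poly_Mapping.single j 1 + m')"
      by (simp add: m' ac_simps)
    ultimately show ?case
      using coeff_var_times_add [of j f m] coeff_var_times_add [of i f "Poly_Mapping.single j 1 + m'"]
      by (simp add: left_diff_distrib)
  qed
  then show ?thesis by (simp add: vanish_below_def)
qed

text \<open>Cancelling a factor costs \<open>k\<close> in the order. The lemma is applied on two
  levels to the double product in \<open>vdm\<close>: with cost 1 inside a row and cost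
  \<open>n\<close> per row.\<close>

lemma vanish_below_prod_cancel:
  assumes "finite S"
    and "\<And>s d f. s \<in> S \<Longrightarrow> vanish_below (d + k) (q s * f) \<Longrightarrow> vanish_below d f"
    and "vanish_below (d + card S * k) (prod q S * f)"
  shows "vanish_below d f"
  using assms
proof (induction S arbitrary: f rule: finite_induct)
  case (insert s S)
  have "vanish_below (d + card S * k + k) (q s * (prod q S * f))"
    using insert by (simp add: ac_simps)
  then have "vanish_below (d + card S * k) (prod q S * f)"
    using insert.prems by blast
  then show ?case using insert by blast
qed simp

lemma vanish_below_mono: "vanish_below d f \<Longrightarrow> c \<le> d \<Longrightarrow> vanish_below c f"
  by (simp add: vanish_below_def)

text \<open>The loss \<open>n * n\<close> is a crude bound for the number of factors.\<close>

lemma vanish_below_vdm_cancel: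
  assumes "vanish_below (d + n * n) (vdm n mfps_var * f)"
  shows "vanish_below d f"
proof (rule vanish_below_prod_cancel)
  show "vanish_below (d + card {1..n} * n) ((\<Prod>i=1..n. \<Prod>j=i+1..n. mfps_var i - mfps_var j) * f)"
    using assms by (simp add: vdm_def)
  fix i d and f :: "'a mfps"
  assume *: "vanish_below (d + n) ((\<Prod>j=i+1..n. mfps_var i - mfps_var j) * f)"
  show "vanish_below d f"
  proof (rule vanish_below_prod_cancel)
    show "vanish_below (d + card {i+1..n} * 1) ((\<Prod>j=i+1..n. mfps_var i - mfps_var j) * f)"
      by (rule vanish_below_mono [OF *]) simp
    fix j d and f :: "'a mfps"
    assume "j \<in> {i+1..n}" "vanish_below (d + 1) ((mfps_var i - mfps_var j) * f)"
    then show "vanish_below d f"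
      using vanish_below_var_diff_cancel [of i j d f] by simp
  qed simp
qed simp

text \<open>Zero vanishes to every order, hence so does \<open>f\<close> after cancellation.\<close>

lemma vdm_var_cancel:
  assumes "vdm n mfps_var * f = 0"
  shows "f = 0"
proof (rule mfps_eqI)
  fix m :: "nat \<Rightarrow>\<^sub>0 nat"
  have "vanish_below (Suc (monom_degree m)) f"
    by (rule vanish_below_vdm_cancel [of _ n]) (simp add: assms)
  then show "mfps_coeff f m = mfps_coeff 0 m"
    by (simp add: vanish_below_def)
qed

section \<open>Substitution into polynomials\<close>

lemma Const_0 [simp]: "Const 0 = 0"
  by (simp add: Const_def)

lemma comm_ring_hom_Const: "comm_ring_hom Const"
  by (rule comm_ring_homI) (simp_all add: Const_def single_add mult_single)

interpretation Const: comm_ring_hom Const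
  by (rule comm_ring_hom_Const)

definition monom_subst :: "('v \<Rightarrow> ('w, 'r::comm_ring_1) mpoly) \<Rightarrow> ('v \<Rightarrow>\<^sub>0 nat) \<Rightarrow> ('w, 'r) mpoly" where
  "monom_subst f m = (\<Prod>v\<in>Poly_Mapping.keys m. f v ^ Poly_Mapping.lookup m v)"

lemma monom_subst_superset:
  assumes "finite S" "Poly_Mapping.keys m \<subseteq> S"
  shows "monom_subst f m = (\<Prod>v\<in>S. f v ^ Poly_Mapping.lookup m v)"
  unfolding monom_subst_def using assms by (intro prod.mono_neutral_left) (auto simp: in_keys_iff)

lemma monom_subst_add: "monom_subst f (p + q) = monom_subst f p * monom_subst f q"
proof -
  let ?S = "Poly_Mapping.keys p \<union> Poly_Mapping.keys q"
  have "monom_subst f (p + q) = (\<Prod>v\<in>?S. f v ^ Poly_Mapping.lookup (p + q) v)"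
    by (rule monom_subst_superset) (auto simp: keys_monom_add)
  then show ?thesis
    by (simp add: lookup_add power_add prod.distrib flip: monom_subst_superset)
qed

lemma mpoly_subst_superset:
  assumes "finite S" "Poly_Mapping.keys p \<subseteq> S"
  shows "mpoly_subst f p = (\<Sum>m\<in>S. Const (Poly_Mapping.lookup p m) * monom_subst f m)"
  unfolding mpoly_subst_def monom_subst_def [symmetric] using assms
  by (intro sum.mono_neutral_left) (auto simp: in_keys_iff)

lemma mpoly_subst_add: "mpoly_subst f (p + q) = mpoly_subst f p + mpoly_subst f q"
proof -
  let ?S = "Poly_Mapping.keys p \<union> Poly_Mapping.keys q"
  have "mpoly_subst f (p + q) = (\<Sum>m\<in>?S. Const (Poly_Mapping.lookup (p + q) m) * monom_subst f m)"
    by (rule mpoly_subst_superset) (use keys_add [of p q] in auto)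
  then show ?thesis
    by (simp add: lookup_add Const.hom_add distrib_right sum.distrib flip: mpoly_subst_superset)
qed

lemma mpoly_subst_single: "mpoly_subst f (Poly_Mapping.single m c) = Const c * monom_subst f m"
  by (subst mpoly_subst_superset [of "{m}"]) auto

lemma mpoly_subst_sum: "mpoly_subst f (sum p S) = (\<Sum>s\<in>S. mpoly_subst f (p s))"
proof (induction S rule: infinite_finite_induct)
  case (insert s S)
  then show ?case by (simp add: mpoly_subst_add)
qed (simp_all add: mpoly_subst_def)

lemma sum_of_monomials:
  fixes p :: "'v \<Rightarrow>\<^sub>0 'r::comm_ring_1"
  shows "(\<Sum>m\<in>Poly_Mapping.keys p. Poly_Mapping.single m (Poly_Mapping.lookup p m)) = p"
  by (rule poly_mapping_eqI) (auto simp: lookup_sum lookup_single when_def in_keys_iff)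

lemma mpoly_subst_mult: "mpoly_subst f (p * q) = mpoly_subst f p * mpoly_subst f q"
proof -
  let ?P = "Poly_Mapping.keys p" and ?Q = "Poly_Mapping.keys q"
  have "p * q = (\<Sum>m\<in>?P. \<Sum>k\<in>?Q. Poly_Mapping.single (m + k) (Poly_Mapping.lookup p m * Poly_Mapping.lookup q k))"
    by (subst (1) sum_of_monomials [of p, symmetric], subst (1) sum_of_monomials [of q, symmetric])
       (simp add: sum_product mult_single)
  then have "mpoly_subst f (p * q) = (\<Sum>m\<in>?P. \<Sum>k\<in>?Q.
      (Const (Poly_Mapping.lookup p m) * monom_subst f m) * (Const (Poly_Mapping.lookup q k) * monom_subst f k))"
    by (simp add: mpoly_subst_sum mpoly_subst_single monom_subst_add Const.hom_mult ac_simps)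
  then show ?thesis
    by (simp add: mpoly_subst_def monom_subst_def sum_product)
qed

lemma mpoly_subst_Const [simp]: "mpoly_subst f (Const c) = Const c"
  unfolding Const_def mpoly_subst_single by (simp add: monom_subst_def Const_def)

lemma mpoly_subst_Var [simp]: "mpoly_subst f (Var v) = f v"
  unfolding Var_def mpoly_subst_single by (simp add: monom_subst_def)

lemma comm_ring_hom_mpoly_subst: "comm_ring_hom (mpoly_subst f)"
proof (rule comm_ring_homI)
  show "mpoly_subst f 1 = 1"
    using mpoly_subst_Const [of f 1] by simp
qed (rule mpoly_subst_add mpoly_subst_mult)+

interpretation mpoly_subst: comm_ring_hom "mpoly_subst f"
  by (rule comm_ring_hom_mpoly_subst)

section \<open>Double Schur functions\<close>

lemma vdm_hom:
  assumes "comm_ring_hom h"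
  shows "h (vdm n x) = vdm n (\<lambda>i. h (x i))"
proof -
  interpret h: comm_ring_hom h by fact
  show ?thesis by (simp add: vdm_def h.hom_prod h.hom_minus)
qed

lemma vdm_cong: "(\<And>i. i \<in> {1..n} \<Longrightarrow> x i = y i) \<Longrightarrow> vdm n x = vdm n y"
  unfolding vdm_def by (intro prod.cong) auto

lemma det_mat_hom:
  assumes "comm_ring_hom h"
  shows "h (Determinant.det (mat n n (\<lambda>(i, j). f i j))) = Determinant.det (mat n n (\<lambda>(i, j). h (f i j)))"
proof -
  interpret h: comm_ring_hom h by fact
  show ?thesis
    unfolding h.hom_det [symmetric] by (rule arg_cong [where f = Determinant.det]) auto
qed

lemma det_mat_cong:
  assumes "\<And>i j. i < n \<Longrightarrow> j < n \<Longrightarrow> f i j = g i j"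
  shows "Determinant.det (mat n n (\<lambda>(i, j). f i j)) = Determinant.det (mat n n (\<lambda>(i, j). g i j))"
  by (rule arg_cong [where f = Determinant.det]) (auto simp: assms)

lemma Var_inject: "Var i = (Var j :: ('v, 'r::comm_ring_1) mpoly) \<longleftrightarrow> i = j"
proof
  assume eq: "Var i = (Var j :: ('v, 'r) mpoly)"
  have "Poly_Mapping.keys (Var v :: ('v, 'r) mpoly) = {Poly_Mapping.single v 1}" for v
    by (simp add: Var_def)
  from this [of i] this [of j] eq have "Poly_Mapping.single i (1::nat) = Poly_Mapping.single j 1" by simp
  then have "Poly_Mapping.keys (Poly_Mapping.single i (1::nat)) = Poly_Mapping.keys (Poly_Mapping.single j (1::nat))"
    by simp
  then show "i = j" by simp
qed simp

lemma vdm_Var_nonzero: "vdm n Var \<noteq> (0 :: xpoly)"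
  by (simp add: vdm_def Var_inject)

text \<open>Replaces the definite description by an equation. Column \<open>j\<close> holds the
  values of one polynomial at all the variables, so the Vandermonde product divides the
  determinant.\<close>

lemma double_schur_times_vdm:
  assumes "length lam \<le> n"
  shows "double_schur lam n * vdm n Var =
    Determinant.det (mat n n (\<lambda>(i, j). factorial_power n (Suc i) (shifted_part lam n j)))"
proof -
  let ?D = "Determinant.det (mat n n (\<lambda>(i, j). factorial_power n (Suc i) (shifted_part lam n j)))"
  let ?p = "\<lambda>j. \<Prod>k<shifted_part lam n j. [:- Const (avar (int n - int k)), 1:]"
  have "?D = Determinant.det (mat n n (\<lambda>(i, j). poly (?p j) (Var (Suc i))))"
    by (rule det_mat_cong) (simp add: factorial_power_def poly_prod)
  then have "vdm n Var dvd ?D"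
    using vdm_dvd_det_poly [of n Var ?p] by simp
  then obtain q where q: "?D = q * vdm n Var"
    by (metis dvd_def mult.commute)
  have "exact_quot ?D (vdm n Var) = q"
    by (rule exact_quot_eqI) (use q vdm_Var_nonzero in auto)
  then have "double_schur lam n = q"
    using assms by (simp only: double_schur_def vdm_def shifted_part_def if_True)
  then show ?thesis by (simp only: q)
qed

lemma factorial_power_Suc:
  "factorial_power (Suc n) i (Suc r) = (Var i - Const (avar (int (Suc n)))) * factorial_power n i r"
  unfolding factorial_power_def by (subst prod.lessThan_Suc_shift) (simp add: algebra_simps)

lemma part_pos:
  assumes "lam \<in> partitions" "j < length lam"
  shows "0 < part lam (Suc j)"
proof (rule gr0I)
  assume "part lam (Suc j) = 0"
  then have "0 \<in> set lam" using assms(2) nth_mem [of j lam] by (simp add: part_def)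
  then show False using assms(1) by (simp add: partitions_def)
qed

lemma part_eq_0: "length lam \<le> j \<Longrightarrow> part lam (Suc j) = 0"
  by (simp add: part_def)

text \<open>At x_(n+1) = a_(n+1) the Vandermonde product becomes \<open>?P * vdm n Var\<close>, and
  in the last row only an exponent 0 gives a nonzero entry. The remaining columns lose the factor
  x_i - a_(n+1), and these factors form \<open>?P\<close>.\<close>

lemma double_schur_stable:
  assumes lam: "lam \<in> partitions"
  shows "mpoly_subst (\<lambda>i. if i = Suc n then Const (avar (int (Suc n))) else Var i) (double_schur lam (Suc n)) =
    double_schur lam n"
proof (cases "length lam \<le> Suc n")
  case True
  let ?A = "Const (avar (int (Suc n))) :: xpoly"
  let ?h = "mpoly_subst (\<lambda>i. if i = Suc n then ?A else Var i)"
  let ?P = "\<Prod>i<n. Var (Suc i) - ?A"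
  have h_vdm: "?h (vdm (Suc n) Var) = ?P * vdm n Var"
  proof -
    have "?h (vdm n Var) = vdm n Var"
      unfolding vdm_hom [OF comm_ring_hom_mpoly_subst] by (rule vdm_cong) auto
    then show ?thesis
      by (simp add: vdm_Suc mpoly_subst.hom_mult mpoly_subst.hom_prod mpoly_subst.hom_minus mult.commute)
  qed
  have nz: "?P * vdm n Var \<noteq> 0"
  proof -
    have "Var (Suc i) \<noteq> ?A" for i
    proof
      assume eq: "Var (Suc i) = ?A"
      \<comment> \<open>The two substitutions differ on a variable but agree on constants.\<close>
      have "mpoly_subst (\<lambda>_. 0) (Var (Suc i)) = (0 :: xpoly)" "mpoly_subst (\<lambda>_. 1) (Var (Suc i)) = (1 :: xpoly)"
        by simp_all
      then show False unfolding eq by simp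
    qed
    then show ?thesis by (simp add: vdm_Var_nonzero)
  qed
  have h_ds: "?h (double_schur lam (Suc n)) * (?P * vdm n Var) =
      Determinant.det (mat (Suc n) (Suc n) (\<lambda>(i, j). ?h (factorial_power (Suc n) (Suc i) (shifted_part lam (Suc n) j))))"
    using arg_cong [OF double_schur_times_vdm [OF True], of ?h]
    by (simp only: mpoly_subst.hom_mult h_vdm det_mat_hom [OF comm_ring_hom_mpoly_subst])
  have h_fp: "?h (factorial_power (Suc n) (Suc i) r) = factorial_power (Suc n) (Suc i) r" if "i < n" for i r
    using that by (simp add: factorial_power_def mpoly_subst.hom_prod mpoly_subst.hom_minus)
  have h_last: "?h (factorial_power (Suc n) (Suc n) (Suc r)) = 0" for r
    unfolding factorial_power_Suc by (simp add: mpoly_subst.hom_mult mpoly_subst.hom_minus)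
  have pos: "shifted_part lam (Suc n) j = Suc (shifted_part lam n j)" if "j < n" for j
    using that by (simp add: shifted_part_def)
  show ?thesis
  proof (cases "length lam = Suc n")
    case length: True
    \<comment> \<open>With \<open>n + 1\<close> positive parts even the last exponent is positive,
      so the last row vanishes; this matches the value 0 assigned to
      \<open>double_schur lam n\<close>.\<close>
    have "shifted_part lam (Suc n) n = Suc (part lam (Suc n) - 1)"
      using part_pos [OF lam, of n] length by (simp add: shifted_part_def)
    then have "?h (factorial_power (Suc n) (Suc n) (shifted_part lam (Suc n) j)) = 0" if "j \<le> n" for j
      using that pos [of j] h_last by (cases "j = n") auto
    then have "?h (double_schur lam (Suc n)) * (?P * vdm n Var) = 0"
      unfolding h_ds by (rule det_last_row_zero)
    with nz length show ?thesis by (simp add: double_schur_def)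
  next
    case False
    with True have length: "length lam \<le> n" by simp
    have last: "shifted_part lam (Suc n) n = 0"
      using length by (simp add: shifted_part_def part_eq_0)
    have "?h (double_schur lam (Suc n)) * (?P * vdm n Var) =
        ?h (factorial_power (Suc n) (Suc n) (shifted_part lam (Suc n) n)) *
        Determinant.det (mat n n (\<lambda>(i, j). ?h (factorial_power (Suc n) (Suc i) (shifted_part lam (Suc n) j))))"
      unfolding h_ds by (rule det_last_row_unit) (simp only: pos h_last)
    also have "?h (factorial_power (Suc n) (Suc n) (shifted_part lam (Suc n) n)) = 1"
      by (simp add: last factorial_power_def)
    also have "Determinant.det (mat n n (\<lambda>(i, j). ?h (factorial_power (Suc n) (Suc i) (shifted_part lam (Suc n) j)))) =
        Determinant.det (mat n n (\<lambda>(i, j).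
          (Var (Suc i) - ?A) * 1 * factorial_power n (Suc i) (shifted_part lam n j)))"
      by (rule det_mat_cong) (simp only: pos h_fp, simp only: factorial_power_Suc mult_1_right)
    also have "\<dots> = ?P * (double_schur lam n * vdm n Var)"
      by (subst det_scale) (simp add: double_schur_times_vdm [OF length])
    finally have "?h (double_schur lam (Suc n)) * (?P * vdm n Var) = double_schur lam n * (?P * vdm n Var)"
      by (simp add: ac_simps)
    with nz show ?thesis by simp
  qed
qed (simp add: double_schur_def)

section \<open>Dual Schur functions\<close>

text \<open>As \<open>j - \<lambda>\<^sub>j = n - \<alpha>\<^sub>j\<close> for \<open>\<alpha>\<^sub>j = \<lambda>\<^sub>j + n - j\<close>, the entry \<open>A\<^sub>i\<^sub>j\<close> depends only on
  \<open>\<alpha>\<^sub>j\<close>, and both cases of its definition are instances of one recursion in \<open>\<alpha>\<^sub>j\<close>, see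
  \<open>dual_tail_Suc\<close>.\<close>

definition dual_tail :: "(int \<Rightarrow> 'r::comm_ring_1) \<Rightarrow> nat \<Rightarrow> nat \<Rightarrow> nat \<Rightarrow> 'r mfps" where
  "dual_tail c n M j =
     (if M \<le> n then \<Prod>k = 1..int n - int M. 1 - mfps_const (c k) * mfps_var j
      else \<Prod>k = int n - int M + 1..0. mfps_geometric (c k) j)"

text \<open>The one-variable function g of the overview. The sequence \<open>c\<close> is kept
  general so that it can later be the image of \<open>avar\<close> among the polynomials in
  x.\<close>

definition dual_factor :: "(int \<Rightarrow> 'r::comm_ring_1) \<Rightarrow> nat \<Rightarrow> nat \<Rightarrow> nat \<Rightarrow> 'r mfps" where
  "dual_factor c n \<alpha> j = mfps_var j ^ \<alpha> * dual_tail c n (Suc \<alpha>) j"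

lemma dual_tail_Suc:
  "dual_tail c n (Suc M) j * (1 - mfps_const (c (int n - int M)) * mfps_var j) = dual_tail c n M j"
proof (cases "M < n")
  case True
  then have "{1..int n - int M} = insert (int n - int M) {1..int n - int (Suc M)}" by auto
  with True show ?thesis by (simp add: dual_tail_def mult.commute)
next
  case False
  then have "{int n - int (Suc M) + 1..0} = insert (int n - int M) {int n - int M + 1..0}" by auto
  then have "dual_tail c n (Suc M) j = mfps_geometric (c (int n - int M)) j *
      (\<Prod>k = int n - int M + 1..0. mfps_geometric (c k) j)"
    using False by (simp add: dual_tail_def)
  moreover have "(\<Prod>k = int n - int M + 1..0. mfps_geometric (c k) j) = dual_tail c n M j"
    using False by (cases "M = n") (simp_all add: dual_tail_def)
  moreover have "u * t * w = t" if "u * w = 1" for u t w :: "'a mfps"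
  proof -
    have "u * t * w = (u * w) * t" by (simp only: ac_simps)
    with that show ?thesis by simp
  qed
  ultimately show ?thesis
    using mfps_geometric_inverse [of "c (int n - int M)" j] by simp
qed

lemma dual_tail_le:
  assumes "M \<le> B"
  shows "dual_tail c n M j =
    dual_tail c n B j * (\<Prod>k=M..<B. 1 - mfps_const (c (int n - int k)) * mfps_var j)"
  using assms
proof (induction B rule: dec_induct)
  case (step B)
  then show ?case
    by (simp add: prod.atLeastLessThan_Suc dual_tail_Suc [of c n B j, symmetric] ac_simps)
qed simp

lemma dual_factor_Suc: "dual_factor c (Suc n) (Suc \<alpha>) j = mfps_var j * dual_factor c n \<alpha> j"
proof -
  have "dual_tail c (Suc n) (Suc (Suc \<alpha>)) j = dual_tail c n (Suc \<alpha>) j"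
    by (simp add: dual_tail_def algebra_simps)
  then show ?thesis by (simp add: dual_factor_def mult.assoc)
qed

lemma dual_factor_hom:
  assumes "comm_ring_hom h"
  shows "mfps_map h (dual_factor c n \<alpha> j) = dual_factor (\<lambda>k. h (c k)) n \<alpha> j"
proof -
  interpret h: comm_ring_hom h by fact
  interpret m: comm_ring_hom "mfps_map h" by (rule comm_ring_hom_mfps_map) fact
  show ?thesis
    by (simp add: dual_factor_def dual_tail_def m.hom_mult m.hom_power m.hom_prod m.hom_minus
        mfps_map_var mfps_map_const mfps_geometric_hom [OF assms])
qed

lemma mfps_truncate_dual_tail:
  "mfps_truncate n (dual_tail c N M j) = (if j \<le> n then dual_tail c N M j else 1)"
  by (simp add: dual_tail_def mfps_truncate.hom_prod mfps_truncate.hom_minus mfps_truncate.hom_mult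
      mfps_truncate_var mfps_truncate_geometric)

lemma mfps_truncate_dual_factor:
  "mfps_truncate n (dual_factor c N \<alpha> j) = (if j \<le> n then dual_factor c N \<alpha> j else 0 ^ \<alpha>)"
  by (simp add: dual_factor_def mfps_truncate.hom_mult mfps_truncate.hom_power
      mfps_truncate_var mfps_truncate_dual_tail)

text \<open>The entries are power series, but by \<open>dual_tail_le\<close> each row has a common
  factor \<open>dual_tail c n B\<close>, for one \<open>B\<close> above all exponents; what remains
  are values of polynomials.\<close>

lemma vdm_dvd_det_dual_factor:
  "vdm n mfps_var dvd Determinant.det (mat n n (\<lambda>(i, j). dual_factor c n (\<alpha> j) (Suc i)))"
proof -
  define B where "B = Suc (\<Sum>j<n. \<alpha> j)"
  have B: "Suc (\<alpha> j) \<le> B" if "j < n" for j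
    using member_le_sum [of j "{..<n}" \<alpha>] that by (simp add: B_def)
  let ?p = "\<lambda>j. monom 1 (\<alpha> j) * (\<Prod>k=Suc (\<alpha> j)..<B. [:1, - mfps_const (c (int n - int k)):])"
  have "dual_factor c n (\<alpha> j) i = dual_tail c n B i * 1 * poly (?p j) (mfps_var i)" if "j < n" for i j
    unfolding dual_factor_def dual_tail_le [OF B [OF that]]
    by (simp add: poly_monom poly_prod ac_simps)
  then have "Determinant.det (mat n n (\<lambda>(i, j). dual_factor c n (\<alpha> j) (Suc i))) =
      Determinant.det (mat n n (\<lambda>(i, j). dual_tail c n B (Suc i) * 1 * poly (?p j) (mfps_var (Suc i))))"
    by (intro det_mat_cong) simp
  also have "vdm n mfps_var dvd \<dots>"
    unfolding det_scale by (intro dvd_mult vdm_dvd_det_poly)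
  finally show ?thesis .
qed

text \<open>Parts decrease while row numbers increase, so the rows meeting the main diagonal form an
  initial segment.\<close>

lemma le_diagonal_length_iff:
  assumes lam: "lam \<in> partitions" and j: "1 \<le> j"
  shows "j \<le> diagonal_length lam \<longleftrightarrow> j \<le> part lam j"
proof -
  let ?D = "{i \<in> {1..length lam}. i \<le> part lam i}"
  have down: "i \<in> ?D" if "k \<in> ?D" "1 \<le> i" "i \<le> k" for i k
  proof -
    have "part lam k \<le> part lam i"
      using part_antimono [OF lam, of "i - 1" "k - 1"] that by simp
    with that show ?thesis by (intro CollectI conjI) auto
  qed
  have D: "j \<in> ?D \<longleftrightarrow> j \<le> part lam j"
    using j by (auto simp: part_def split: if_splits)
  show ?thesis
  proof (cases "j \<in> ?D")
    case True
    then have "{1..j} \<subseteq> ?D" using down by (meson atLeastAtMost_iff subsetI)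
    then have "card {1..j} \<le> card ?D" by (rule card_mono [rotated]) simp
    with True D show ?thesis by (simp add: diagonal_length_def)
  next
    case False
    have "k < j" if "k \<in> ?D" for k
      using down [OF that j] False by (meson not_le)
    then have "?D \<subseteq> {1..<j}" by auto
    then have "card ?D \<le> card {1..<j}" by (intro card_mono) auto
    then have "\<not> j \<le> card ?D" using j by simp
    with False D show ?thesis unfolding diagonal_length_def by blast
  qed
qed

text \<open>The test against the diagonal length amounts to comparing the part with its row number,
  that is, the exponent with \<open>n\<close>, which is the case distinction in
  \<open>dual_tail\<close>.\<close>

lemma dual_schur_entry_eq:
  assumes lam: "lam \<in> partitions" and j: "j < n"
  shows "dual_schur_entry lam n i (Suc j) = dual_factor avar n (shifted_part lam n j) i"
proof (cases "Suc j \<le> part lam (Suc j)")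
  case True
  then have "Suc j \<le> diagonal_length lam" using le_diagonal_length_iff [OF lam, of "Suc j"] by simp
  moreover have "(\<Prod>k = int (Suc j) - int (part lam (Suc j))..0. mfps_geometric (avar k) i) *
      (\<Prod>k = int (Suc j) - int (part lam (Suc j))..0. 1 - mfps_const (avar k) * mfps_var i) = 1"
    by (simp add: mfps_geometric_inverse flip: prod.distrib)
  moreover have "int n - int (Suc (shifted_part lam n j)) + 1 = int (Suc j) - int (part lam (Suc j))"
    "\<not> Suc (shifted_part lam n j) \<le> n"
    using True j by (simp_all add: shifted_part_def of_nat_diff)
  ultimately show ?thesis
    by (simp only: dual_schur_entry_def dual_factor_def dual_tail_def exact_quot_unit if_True if_False)
       (simp add: shifted_part_def)
next
  case False
  then have "\<not> Suc j \<le> diagonal_length lam" using le_diagonal_length_iff [OF lam, of "Suc j"] by simp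
  moreover have "int n - int (Suc (shifted_part lam n j)) = int (Suc j) - int (part lam (Suc j)) - 1"
    "Suc (shifted_part lam n j) \<le> n"
    using False j by (simp_all add: shifted_part_def of_nat_diff)
  ultimately show ?thesis
    by (simp only: dual_schur_entry_def dual_factor_def dual_tail_def if_True if_False)
       (simp add: shifted_part_def)
qed

lemma dual_schur_finite_times_vdm:
  assumes lam: "lam \<in> partitions" and length: "length lam \<le> n"
  shows "dual_schur_finite lam n * vdm n mfps_var =
    Determinant.det (mat n n (\<lambda>(i, j). dual_factor avar n (shifted_part lam n j) (Suc i)))"
proof -
  let ?D = "Determinant.det (mat n n (\<lambda>(i, j). dual_factor avar n (shifted_part lam n j) (Suc i)))"
  obtain q where q: "?D = q * vdm n mfps_var"
    using vdm_dvd_det_dual_factor [of n avar] by (metis dvd_def mult.commute)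
  have "exact_quot ?D (vdm n mfps_var) = q"
  proof (rule exact_quot_eqI)
    fix s :: "apoly mfps" assume "s * vdm n mfps_var = 0"
    then have "vdm n mfps_var * s = 0" by (subst mult.commute)
    then show "s = 0" by (rule vdm_var_cancel)
  qed (rule q [symmetric])
  moreover have "Determinant.det (mat n n (\<lambda>(i, j). dual_schur_entry lam n (Suc i) (Suc j))) = ?D"
    by (rule det_mat_cong) (rule dual_schur_entry_eq [OF lam])
  ultimately have "dual_schur_finite lam n = q"
    using length by (simp only: dual_schur_finite_def vdm_def if_True)
  then show ?thesis by (simp only: q)
qed

lemma prod_var_cancel:
  assumes "(\<Prod>i<n. mfps_var (Suc i)) * f = 0"
  shows "f = 0"
  using assms
proof (induction n arbitrary: f)
  case (Suc n)
  have "(\<Prod>i<n. mfps_var (Suc i)) * (mfps_var (Suc n) * f) = 0"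
    using Suc.prems by (simp add: ac_simps)
  then have "mfps_var (Suc n) * f = 0" by (rule Suc.IH)
  then show "f = 0"
    by (intro mfps_eqI) (metis coeff_var_times_add coeff_0)
qed simp

text \<open>The argument of \<open>double_schur_stable\<close> with y_(n+1) = 0: the Vandermonde
  product becomes y_1 ... y_n times the smaller one, and \<open>dual_factor_Suc\<close> extracts the
  matching factor y_i from each row.\<close>

lemma truncate_dual_schur_finite:
  assumes lam: "lam \<in> partitions"
  shows "mfps_truncate n (dual_schur_finite lam (Suc n)) = dual_schur_finite lam n"
proof (cases "length lam \<le> Suc n")
  case True
  let ?h = "mfps_truncate n :: apoly mfps \<Rightarrow> _"
  let ?P = "\<Prod>i<n. mfps_var (Suc i) :: apoly mfps"
  have cancel: "f = g" if "f * (?P * vdm n mfps_var) = g * (?P * vdm n mfps_var)" for f g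
  proof -
    have "?P * (vdm n mfps_var * (f - g)) = 0"
      using that by (simp add: algebra_simps)
    then have "f - g = 0" by (rule vdm_var_cancel [OF prod_var_cancel])
    then show ?thesis by simp
  qed
  have h_vdm: "?h (vdm (Suc n) mfps_var) = ?P * vdm n mfps_var"
  proof -
    have "?h (vdm n mfps_var) = vdm n mfps_var"
      unfolding vdm_hom [OF comm_ring_hom_mfps_truncate] by (rule vdm_cong) (simp add: mfps_truncate_var)
    then show ?thesis
      by (simp add: vdm_Suc mfps_truncate.hom_mult mfps_truncate.hom_prod mfps_truncate.hom_minus
          mfps_truncate_var mult.commute)
  qed
  have h_ds: "?h (dual_schur_finite lam (Suc n)) * (?P * vdm n mfps_var) =
      Determinant.det (mat (Suc n) (Suc n) (\<lambda>(i, j). ?h (dual_factor avar (Suc n) (shifted_part lam (Suc n) j) (Suc i))))"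
    using arg_cong [OF dual_schur_finite_times_vdm [OF lam True], of ?h]
    by (simp only: mfps_truncate.hom_mult h_vdm det_mat_hom [OF comm_ring_hom_mfps_truncate])
  have pos: "shifted_part lam (Suc n) j = Suc (shifted_part lam n j)" if "j < n" for j
    using that by (simp add: shifted_part_def)
  show ?thesis
  proof (cases "length lam = Suc n")
    case length: True
    have "shifted_part lam (Suc n) n = Suc (part lam (Suc n) - 1)"
      using part_pos [OF lam, of n] length by (simp add: shifted_part_def)
    then have "?h (dual_factor avar (Suc n) (shifted_part lam (Suc n) j) (Suc n)) = 0" if "j \<le> n" for j
      using that pos [of j] by (cases "j = n") (auto simp: mfps_truncate_dual_factor)
    then have "?h (dual_schur_finite lam (Suc n)) * (?P * vdm n mfps_var) = 0"
      unfolding h_ds by (rule det_last_row_zero)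
    then have "?h (dual_schur_finite lam (Suc n)) = 0" by (rule cancel [of _ 0, unfolded mult_zero_left])
    with length show ?thesis by (simp add: dual_schur_finite_def)
  next
    case False
    with True have length: "length lam \<le> n" by simp
    have last: "shifted_part lam (Suc n) n = 0"
      using length by (simp add: shifted_part_def part_eq_0)
    have "?h (dual_schur_finite lam (Suc n)) * (?P * vdm n mfps_var) =
        ?h (dual_factor avar (Suc n) (shifted_part lam (Suc n) n) (Suc n)) *
        Determinant.det (mat n n (\<lambda>(i, j). ?h (dual_factor avar (Suc n) (shifted_part lam (Suc n) j) (Suc i))))"
      unfolding h_ds by (rule det_last_row_unit) (simp add: pos mfps_truncate_dual_factor)
    also have "?h (dual_factor avar (Suc n) (shifted_part lam (Suc n) n) (Suc n)) = 1"
      by (simp add: last mfps_truncate_dual_factor)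
    also have "Determinant.det (mat n n (\<lambda>(i, j). ?h (dual_factor avar (Suc n) (shifted_part lam (Suc n) j) (Suc i)))) =
        Determinant.det (mat n n (\<lambda>(i, j).
          mfps_var (Suc i) * 1 * dual_factor avar n (shifted_part lam n j) (Suc i)))"
      by (rule det_mat_cong) (simp add: pos mfps_truncate_dual_factor, simp add: dual_factor_Suc)
    also have "\<dots> = ?P * (dual_schur_finite lam n * vdm n mfps_var)"
      by (subst det_scale) (simp add: dual_schur_finite_times_vdm [OF lam length])
    finally have "?h (dual_schur_finite lam (Suc n)) * (?P * vdm n mfps_var) =
        dual_schur_finite lam n * (?P * vdm n mfps_var)"
      by (simp add: ac_simps)
    then show ?thesis by (rule cancel)
  qed
qed (simp add: dual_schur_finite_def)

text \<open>Evaluates the definite description: a limit exists by compatibility, and truncations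
  determine a series.\<close>

lemma truncate_dual_schur:
  assumes "lam \<in> partitions"
  shows "mfps_truncate n (dual_schur lam) = dual_schur_finite lam n"
proof -
  obtain G where G: "\<And>n. mfps_truncate n G = dual_schur_finite lam n"
    using ex_limit_of_truncations truncate_dual_schur_finite [OF assms] by metis
  have "dual_schur lam = G"
    unfolding dual_schur_def by (rule the_equality) (simp_all add: G mfps_truncate_eqI)
  then show ?thesis by (simp add: G)
qed

text \<open>Every Leibniz term contains an entry of column \<open>j\<close>.\<close>

lemma vanish_below_det_column:
  assumes "j < n" and "\<And>i. i < n \<Longrightarrow> vanish_below d (f i j)"
  shows "vanish_below d (Determinant.det (mat n n (\<lambda>(i, j). f i j)))"
  unfolding det_mat_eq_sum
proof (intro vanish_below_sum vanish_below_mult_left)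
  fix p assume "p \<in> {p. p permutes {0..<n}}"
  then have p: "p permutes {0..<n}" by simp
  obtain i where i: "i < n" "p i = j"
    using \<open>j < n\<close> permutes_image [OF p] by (metis atLeastLessThan_iff imageE zero_le)
  have "(\<Prod>i = 0..<n. f i (p i)) = f i (p i) * (\<Prod>i\<in>{0..<n} - {i}. f i (p i))"
    using i by (intro prod.remove) auto
  then show "vanish_below d (\<Prod>i = 0..<n. f i (p i))"
    using i assms by (simp add: vanish_below_mult_right)
qed

text \<open>The first column has order at least \<open>part lam 1 + n - 1\<close>, of which division
  by the Vandermonde product loses at most \<open>n * n\<close>. Hence partitions with a large first
  part do not affect a given coefficient.\<close>

lemma vanish_below_dual_schur_finite:
  assumes lam: "lam \<in> partitions" and d: "d + n * n \<le> part lam 1 + n - 1" and n: "0 < n"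
  shows "vanish_below d (dual_schur_finite lam n)"
proof (cases "length lam \<le> n")
  case True
  have "vanish_below (part lam 1 + n - 1)
      (Determinant.det (mat n n (\<lambda>(i, j). dual_factor avar n (shifted_part lam n j) (Suc i))))"
    by (rule vanish_below_det_column [of 0])
       (use n in \<open>auto simp: dual_factor_def shifted_part_def intro!: vanish_below_mult_right vanish_below_var_power\<close>)
  then have "vanish_below (d + n * n) (vdm n mfps_var * dual_schur_finite lam n)"
    unfolding mult.commute [of "vdm n mfps_var"] dual_schur_finite_times_vdm [OF lam True]
    by (rule vanish_below_mono [OF _ d])
  then show ?thesis by (rule vanish_below_vdm_cancel)
qed (simp add: dual_schur_finite_def)

section \<open>The Cauchy kernel\<close>

definition cauchy_factor :: "nat \<Rightarrow> nat \<Rightarrow> xpoly mfps" where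
  "cauchy_factor n j =
     (\<Prod>i=1..n. (1 - mfps_const (Const (avar (int i))) * mfps_var j) * mfps_geometric (Var i) j)"

lemma truncate_prod_cauchy_factor:
  "mfps_truncate t (\<Prod>j<Suc t. cauchy_factor n (Suc j)) = (\<Prod>j<t. cauchy_factor n (Suc j))"
proof -
  have "mfps_truncate t (cauchy_factor n j) = (if j \<le> t then cauchy_factor n j else 1)" for j
    by (simp add: cauchy_factor_def mfps_truncate.hom_prod mfps_truncate.hom_mult
        mfps_truncate.hom_minus mfps_truncate_var mfps_truncate_geometric)
  then show ?thesis
    by (simp add: mfps_truncate.hom_prod mfps_truncate.hom_mult)
qed

text \<open>The infinite product over all y_j, specified by its truncations, which determine it by
  \<open>mfps_truncate_eqI\<close>.\<close>

definition cauchy_kernel :: "nat \<Rightarrow> xpoly mfps" where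
  "cauchy_kernel n = (SOME K. \<forall>t. mfps_truncate t K = (\<Prod>j<t. cauchy_factor n (Suc j)))"

lemma truncate_cauchy_kernel:
  "mfps_truncate t (cauchy_kernel n) = (\<Prod>j<t. cauchy_factor n (Suc j))"
proof -
  obtain K where "\<And>t. mfps_truncate t K = (\<Prod>j<t. cauchy_factor n (Suc j))"
    using ex_limit_of_truncations [of "\<lambda>t. \<Prod>j<t. cauchy_factor n (Suc j)"]
      truncate_prod_cauchy_factor by blast
  then have "\<exists>K. \<forall>t. mfps_truncate t K = (\<Prod>j<t. cauchy_factor n (Suc j))" by blast
  from someI_ex [OF this] show ?thesis unfolding cauchy_kernel_def by blast
qed

lemma coeff_cauchy_kernel:
  assumes "Poly_Mapping.keys m \<subseteq> {..t}"
  shows "mfps_coeff (cauchy_kernel n) m = mfps_coeff (\<Prod>j<t. cauchy_factor n (Suc j)) m"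
  unfolding truncate_cauchy_kernel [symmetric] by (simp add: coeff_truncate assms)

lemma has_prod_cauchy_kernel: "(\<lambda>j. cauchy_factor n (Suc j)) has_prod cauchy_kernel n"
proof -
  have "(\<lambda>t. \<Prod>j\<le>t. cauchy_factor n (Suc j)) \<longlonglongrightarrow> cauchy_kernel n"
  proof (rule tendsto_mfps)
    fix m :: "nat \<Rightarrow>\<^sub>0 nat"
    obtain t where t: "Poly_Mapping.keys m \<subseteq> {..t}" using finite_keys_bounded [of m] by blast
    have "mfps_coeff (\<Prod>j\<le>s. cauchy_factor n (Suc j)) m = mfps_coeff (cauchy_kernel n) m" if "t \<le> s" for s
    proof -
      have "{..t} \<subseteq> {..Suc s}" using that by auto
      with t have "Poly_Mapping.keys m \<subseteq> {..Suc s}" by (rule subset_trans)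
      then show ?thesis
        using coeff_cauchy_kernel [of m "Suc s" n] by (simp add: lessThan_Suc_atMost)
    qed
    then show "\<forall>\<^sub>F s in sequentially.
        mfps_coeff (\<Prod>j\<le>s. cauchy_factor n (Suc j)) m = mfps_coeff (cauchy_kernel n) m"
      by (auto simp: eventually_sequentially)
  qed
  \<comment> \<open>The notion \<open>has_prod\<close> demands a nonzero limit; here the truncation
    at level 0 is the empty product.\<close>
  moreover have "cauchy_kernel n \<noteq> 0"
    using truncate_cauchy_kernel [of 0 n] by auto
  ultimately show ?thesis
    by (simp add: has_prod_def raw_has_prod_def)
qed

section \<open>Substitutions in the Cauchy kernel: symmetry and stability\<close>

lemma mfps_map_cauchy_factor:
  assumes "comm_ring_hom h" and h: "\<And>c. h (Const c) = Const c"
  shows "mfps_map h (cauchy_factor n j) =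
    (\<Prod>i=1..n. (1 - mfps_const (Const (avar (int i))) * mfps_var j) * mfps_geometric (h (Var i)) j)"
proof -
  interpret h: comm_ring_hom h by fact
  interpret m: comm_ring_hom "mfps_map h" by (rule comm_ring_hom_mfps_map) fact
  show ?thesis
    by (simp add: cauchy_factor_def m.hom_prod m.hom_mult m.hom_minus h
        mfps_map_var mfps_map_const mfps_geometric_hom [OF assms(1)])
qed

text \<open>Coefficientwise homomorphisms commute with truncation, so identities for the kernel can
  be checked on single factors.\<close>

lemma mfps_map_cauchy_kernel:
  assumes "comm_ring_hom h" and "\<And>j. mfps_map h (cauchy_factor n j) = cauchy_factor k j"
  shows "mfps_map h (cauchy_kernel n) = cauchy_kernel k"
proof (rule mfps_truncate_eqI)
  fix t
  interpret h: comm_ring_hom h by fact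
  interpret m: comm_ring_hom "mfps_map h" by (rule comm_ring_hom_mfps_map) fact
  show "mfps_truncate t (mfps_map h (cauchy_kernel n)) = mfps_truncate t (cauchy_kernel k)"
    by (simp add: mfps_map_truncate [symmetric] truncate_cauchy_kernel m.hom_prod assms(2))
qed

lemma cauchy_kernel_symmetric:
  assumes "\<pi> permutes {1..n}"
  shows "mpoly_subst (\<lambda>i. Var (\<pi> i)) (mfps_coeff (cauchy_kernel n) m) = mfps_coeff (cauchy_kernel n) m"
proof -
  have "mfps_map (mpoly_subst (\<lambda>i. Var (\<pi> i))) (cauchy_kernel n) = cauchy_kernel n"
  proof (rule mfps_map_cauchy_kernel [OF comm_ring_hom_mpoly_subst])
    fix j
    have "(\<Prod>i=1..n. mfps_geometric (Var (\<pi> i) :: xpoly) j) = (\<Prod>i=1..n. mfps_geometric (Var i) j)"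
      using prod.permute [OF assms, of "\<lambda>i. mfps_geometric (Var i :: xpoly) j"] by (simp add: comp_def)
    then show "mfps_map (mpoly_subst (\<lambda>i. Var (\<pi> i))) (cauchy_factor n j) = cauchy_factor n j"
      by (subst mfps_map_cauchy_factor [OF comm_ring_hom_mpoly_subst])
         (simp_all add: cauchy_factor_def prod.distrib)
  qed
  from arg_cong [OF this, of "\<lambda>f. mfps_coeff f m"] show ?thesis
    by (simp only: coeff_map)
qed

text \<open>At x_(n+1) = a_(n+1) the last numerator cancels the last denominator in every
  factor.\<close>

lemma cauchy_kernel_stable:
  "mpoly_subst (\<lambda>i. if i = Suc n then Const (avar (int (Suc n))) else Var i) (mfps_coeff (cauchy_kernel (Suc n)) m) =
     mfps_coeff (cauchy_kernel n) m"
proof -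
  let ?A = "Const (avar (int (Suc n))) :: xpoly"
  let ?h = "mpoly_subst (\<lambda>i. if i = Suc n then ?A else Var i)"
  have "mfps_map ?h (cauchy_kernel (Suc n)) = cauchy_kernel n"
  proof (rule mfps_map_cauchy_kernel [OF comm_ring_hom_mpoly_subst])
    fix j
    have "mfps_map ?h (cauchy_factor (Suc n) j) =
        (\<Prod>i=1..Suc n. (1 - mfps_const (Const (avar (int i))) * mfps_var j) * mfps_geometric (?h (Var i)) j)"
      by (rule mfps_map_cauchy_factor [OF comm_ring_hom_mpoly_subst mpoly_subst_Const])
    also have "\<dots> = (\<Prod>i=1..n. (1 - mfps_const (Const (avar (int i))) * mfps_var j) * mfps_geometric (?h (Var i)) j) *
        (mfps_geometric ?A j * (1 - mfps_const ?A * mfps_var j))"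
      by (simp add: mult.commute)
    also have "\<dots> = cauchy_factor n j"
      unfolding mfps_geometric_inverse cauchy_factor_def by (simp cong: prod.cong_simp)
    finally show "mfps_map ?h (cauchy_factor (Suc n) j) = cauchy_factor n j" .
  qed
  from arg_cong [OF this, of "\<lambda>f. mfps_coeff f m"] show ?thesis
    by (simp only: coeff_map)
qed

text \<open>In the kernel each x_i comes with a power of y at least as large. This property is
  closed under products and bounds the x-degree of a coefficient independently of \<open>n\<close>,
  as \<open>double_symmetric_functions\<close> requires.\<close>

definition graded :: "nat \<Rightarrow> xpoly mfps \<Rightarrow> bool" where
  "graded n f \<longleftrightarrow> (\<forall>m. \<forall>\<mu>\<in>Poly_Mapping.keys (mfps_coeff f m).
     Poly_Mapping.keys \<mu> \<subseteq> {1..n} \<and> monom_degree \<mu> \<le> monom_degree m)"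

lemma gradedD:
  assumes "graded n f" "\<mu> \<in> Poly_Mapping.keys (mfps_coeff f m)"
  shows "Poly_Mapping.keys \<mu> \<subseteq> {1..n}" "monom_degree \<mu> \<le> monom_degree m"
  using assms unfolding graded_def by blast+

lemma keys_Const_subset: "Poly_Mapping.keys (Const c) \<subseteq> {0}"
  by (simp add: Const_def)

lemma graded_map_Const: "graded n (mfps_map Const f)"
  unfolding graded_def using keys_Const_subset by fastforce

lemma graded_mult:
  assumes f: "graded n f" and g: "graded n g"
  shows "graded n (f * g)"
  unfolding graded_def
proof (intro allI ballI)
  fix m \<mu> assume "\<mu> \<in> Poly_Mapping.keys (mfps_coeff (f * g) m)"
  then obtain u where u: "u \<in> {(p, q). p + q = m}"
    "\<mu> \<in> Poly_Mapping.keys (case u of (p, q) \<Rightarrow> mfps_coeff f p * mfps_coeff g q)"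
    unfolding coeff_times using keys_sum by fast
  obtain p q where pq: "u = (p, q)" by (cases u)
  then have m: "m = p + q" and "\<mu> \<in> Poly_Mapping.keys (mfps_coeff f p * mfps_coeff g q)"
    using u by auto
  then obtain \<alpha> \<beta> where \<mu>: "\<mu> = \<alpha> + \<beta>" and \<alpha>: "\<alpha> \<in> Poly_Mapping.keys (mfps_coeff f p)"
    and \<beta>: "\<beta> \<in> Poly_Mapping.keys (mfps_coeff g q)"
    using keys_mult by blast
  show "Poly_Mapping.keys \<mu> \<subseteq> {1..n} \<and> monom_degree \<mu> \<le> monom_degree m"
    using gradedD [OF f \<alpha>] gradedD [OF g \<beta>] by (auto simp: \<mu> m keys_monom_add)
qed

lemma graded_prod: "(\<And>s. s \<in> S \<Longrightarrow> graded n (f s)) \<Longrightarrow> graded n (prod f S)"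
proof (induction S rule: infinite_finite_induct)
  case (insert s S)
  then show ?case by (simp add: graded_mult)
qed (simp_all add: graded_def coeff_1)

lemma Var_power: "Var v ^ k = Poly_Mapping.single (Poly_Mapping.single v k) 1"
  by (induction k) (simp_all add: Var_def mult_single single_add [symmetric])

lemma graded_geometric:
  assumes "i \<in> {1..n}"
  shows "graded n (mfps_geometric (Var i) j)"
  unfolding graded_def
proof (intro allI ballI)
  fix m \<mu> assume \<mu>: "\<mu> \<in> Poly_Mapping.keys (mfps_coeff (mfps_geometric (Var i) j :: xpoly mfps) m)"
  let ?k = "Poly_Mapping.lookup m j"
  have m: "m = Poly_Mapping.single j ?k" and "\<mu> = Poly_Mapping.single i ?k"
    using \<mu> by (auto simp: mfps_geometric_def Var_power split: if_splits)
  moreover have "monom_degree m = ?k"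
    using arg_cong [OF m, of monom_degree] by (simp only: monom_degree_single)
  ultimately show "Poly_Mapping.keys \<mu> \<subseteq> {1..n} \<and> monom_degree \<mu> \<le> monom_degree m"
    using assms by simp
qed

lemma graded_cauchy_kernel: "graded n (cauchy_kernel n)"
proof -
  interpret C: comm_ring_hom "mfps_map (Const :: apoly \<Rightarrow> xpoly)"
    by (rule comm_ring_hom_mfps_map [OF comm_ring_hom_Const])
  \<comment> \<open>The numerators have coefficients free of x, so \<open>graded_map_Const\<close>
    applies to them.\<close>
  have lin: "1 - mfps_const (Const c) * mfps_var j =
      mfps_map (Const :: apoly \<Rightarrow> xpoly) (1 - mfps_const c * mfps_var j)" for c j
    by (simp add: C.hom_minus C.hom_mult mfps_map_const mfps_map_var)
  have *: "graded n (\<Prod>j<t. cauchy_factor n (Suc j))" for t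
    unfolding cauchy_factor_def lin
    by (intro graded_prod graded_mult graded_map_Const graded_geometric)
  show ?thesis
    unfolding graded_def
  proof (intro allI ballI)
    fix m \<mu> assume \<mu>: "\<mu> \<in> Poly_Mapping.keys (mfps_coeff (cauchy_kernel n) m)"
    obtain t where "Poly_Mapping.keys m \<subseteq> {..t}" using finite_keys_bounded [of m] by blast
    then show "Poly_Mapping.keys \<mu> \<subseteq> {1..n} \<and> monom_degree \<mu> \<le> monom_degree m"
      using gradedD [OF *] \<mu> coeff_cauchy_kernel [of m t n] by simp
  qed
qed

lemma cauchy_kernel_double_symmetric:
  "(\<lambda>n. mfps_coeff (cauchy_kernel n) m) \<in> double_symmetric_functions"
  unfolding double_symmetric_functions_def
proof (intro CollectI conjI)
  show "\<forall>n. \<forall>\<mu>\<in>Poly_Mapping.keys (mfps_coeff (cauchy_kernel n) m). Poly_Mapping.keys \<mu> \<subseteq> {1..n}"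
    using gradedD(1) [OF graded_cauchy_kernel] by blast
  show "\<exists>D. \<forall>n. \<forall>\<mu>\<in>Poly_Mapping.keys (mfps_coeff (cauchy_kernel n) m). monom_degree \<mu> \<le> D"
    using gradedD(2) [OF graded_cauchy_kernel] by blast
  show "\<forall>n \<pi>. \<pi> permutes {1..n} \<longrightarrow> mpoly_subst (\<lambda>i. Var (\<pi> i)) (mfps_coeff (cauchy_kernel n) m) =
      mfps_coeff (cauchy_kernel n) m"
    using cauchy_kernel_symmetric by blast
  show "\<forall>n\<ge>1. mpoly_subst (\<lambda>i. if i = n then Const (avar (int n)) else Var i) (mfps_coeff (cauchy_kernel n) m) =
      mfps_coeff (cauchy_kernel (n - 1)) m"
  proof (intro allI impI)
    fix n :: nat assume "1 \<le> n"
    then obtain k where "n = Suc k" by (cases n) auto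
    then show "mpoly_subst (\<lambda>i. if i = n then Const (avar (int n)) else Var i) (mfps_coeff (cauchy_kernel n) m) =
        mfps_coeff (cauchy_kernel (n - 1)) m"
      by (simp only: cauchy_kernel_stable diff_Suc_1)
  qed
qed

section \<open>The identity for finitely many variables\<close>

text \<open>The expansion of \<open>\<Prod>\<^sub>k (1 - a\<^sub>k y) / (1 - x y)\<close> in the basis \<open>(x\<parallel>a)\<^sup>\<alpha>\<close> telescopes because
  \<open>1 - x y = (1 - a y) - (x - a) y\<close>.\<close>

lemma cauchy_telescope:
  "(1 - mfps_const (Var i) * mfps_var j) *
     (\<Sum>\<alpha><M. mfps_const (factorial_power n i \<alpha>) * dual_factor (\<lambda>k. Const (avar k)) n \<alpha> j) =
   dual_tail (\<lambda>k. Const (avar k)) n 0 j -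
     mfps_const (factorial_power n i M) * (mfps_var j ^ M * dual_tail (\<lambda>k. Const (avar k)) n M j)"
proof (induction M)
  case (Suc M)
  let ?c = "\<lambda>k. Const (avar k) :: xpoly"
  let ?a = "mfps_const (?c (int n - int M))"
  have T: "dual_tail ?c n M j = dual_tail ?c n (Suc M) j * (1 - ?a * mfps_var j)"
    by (rule dual_tail_Suc [symmetric])
  have F: "mfps_const (factorial_power n i (Suc M)) =
      mfps_const (factorial_power n i M) * (mfps_const (Var i) - ?a)"
    by (simp add: factorial_power_def mfps_const.hom_mult mfps_const.hom_minus)
  show ?case
    unfolding sum.lessThan_Suc distrib_left Suc
    unfolding F T dual_factor_def by (simp add: algebra_simps)
qed (simp add: factorial_power_def)

lemma dual_tail_0_times_geometric:
  "dual_tail (\<lambda>k. Const (avar k)) n 0 j * (\<Prod>i<n. mfps_geometric (Var (Suc i)) j) = cauchy_factor n j"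
proof -
  have "(\<Prod>k = 1..int n. 1 - mfps_const (Const (avar k) :: xpoly) * mfps_var j) =
      (\<Prod>i<n. 1 - mfps_const (Const (avar (int (Suc i)))) * mfps_var j)"
    by (rule prod.reindex_bij_witness [of _ "\<lambda>i. int (Suc i)" "\<lambda>k. nat (k - 1)"]) auto
  then show ?thesis
    by (simp add: dual_tail_def cauchy_factor_def prod.atLeast1_atMost_eq prod.distrib)
qed

text \<open>Congruence of entries modulo terms of order \<open>d\<close> passes to determinants
  through the Leibniz formula.\<close>

lemma vanish_below_det_diff:
  assumes "\<And>i j. i < n \<Longrightarrow> j < n \<Longrightarrow> vanish_below d (f i j - g i j)"
  shows "vanish_below d (Determinant.det (mat n n (\<lambda>(i, j). f i j)) - Determinant.det (mat n n (\<lambda>(i, j). g i j)))"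
  unfolding det_mat_eq_sum sum_subtractf [symmetric] right_diff_distrib [symmetric]
proof (intro vanish_below_sum vanish_below_mult_left vanish_below_prod_diff assms)
  fix p i assume "p \<in> {p. p permutes {0..<n}}" "i \<in> {0..<n}"
  then show "i < n" "p i < n" using permutes_in_image [of p "{0..<n}" i] by auto
qed

text \<open>After multiplication by both Vandermonde products, Cauchy-Binet turns the sum, and
  Cauchy's formula the product, into determinants whose entries agree up to order \<open>M\<close>.
  Cancelling the Vandermonde product in y costs \<open>N * N\<close>. For \<open>M < N * N\<close>
  the natural subtraction gives 0 and the claim is void.\<close>

lemma truncated_cauchy_identity:
  "vanish_below (M - N * N)
     ((\<Sum>lam\<in>bounded_partitions N M.
         mfps_const (double_schur lam N) * mfps_map Const (dual_schur_finite lam N)) -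
      (\<Prod>j<N. cauchy_factor N (Suc j)))"
proof (cases "N * N \<le> M")
  case True
  let ?C = "mfps_map Const :: apoly mfps \<Rightarrow> xpoly mfps"
  let ?c = "\<lambda>k. Const (avar k) :: xpoly"
  let ?X = "vdm N (\<lambda>i. mfps_const (Var i)) :: xpoly mfps" and ?Y = "vdm N mfps_var :: xpoly mfps"
  let ?S = "\<Sum>lam\<in>bounded_partitions N M. mfps_const (double_schur lam N) * ?C (dual_schur_finite lam N)"
  let ?K = "\<Prod>j<N. cauchy_factor N (Suc j)"
  let ?A = "\<lambda>i \<alpha>. mfps_const (factorial_power N (Suc i) \<alpha>)"
  let ?B = "\<lambda>j \<alpha>. dual_factor ?c N \<alpha> (Suc j)"
  let ?u = "\<lambda>i j. mfps_geometric (Var (Suc i)) (Suc j) :: xpoly mfps"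
  let ?T = "\<lambda>j. dual_tail ?c N 0 (Suc j)"
  interpret C: comm_ring_hom ?C
    by (rule comm_ring_hom_mfps_map [OF comm_ring_hom_Const])
  have X: "mfps_const (vdm N Var) = ?X"
    by (rule vdm_hom [OF comm_ring_hom_mfps_const])
  have Y: "?C (vdm N mfps_var) = ?Y"
    unfolding vdm_hom [OF C.comm_ring_hom_axioms] by (simp add: mfps_map_var)
  have "?X * ?Y * ?S = (\<Sum>lam\<in>bounded_partitions N M.
       Determinant.det (mat N N (\<lambda>(i, j). ?A i (shifted_part lam N j))) *
       Determinant.det (mat N N (\<lambda>(i, j). ?B i (shifted_part lam N j))))"
    unfolding sum_distrib_left
  proof (rule sum.cong [OF refl])
    fix lam assume "lam \<in> bounded_partitions N M"
    then have lam: "lam \<in> partitions" "length lam \<le> N" by (auto simp: bounded_partitions_def)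
    have "mfps_const (double_schur lam N) * ?X =
        Determinant.det (mat N N (\<lambda>(i, j). ?A i (shifted_part lam N j)))"
      unfolding X [symmetric] mfps_const.hom_mult [symmetric] double_schur_times_vdm [OF lam(2)]
      by (rule det_mat_hom [OF comm_ring_hom_mfps_const])
    moreover have "?C (dual_schur_finite lam N) * ?Y =
        Determinant.det (mat N N (\<lambda>(i, j). ?B i (shifted_part lam N j)))"
      unfolding Y [symmetric] C.hom_mult [symmetric] dual_schur_finite_times_vdm [OF lam]
        det_mat_hom [OF C.comm_ring_hom_axioms] dual_factor_hom [OF comm_ring_hom_Const] ..
    moreover have "?X * ?Y * (mfps_const (double_schur lam N) * ?C (dual_schur_finite lam N)) =
        (mfps_const (double_schur lam N) * ?X) * (?C (dual_schur_finite lam N) * ?Y)"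
      by (simp only: ac_simps)
    ultimately show "?X * ?Y * (mfps_const (double_schur lam N) * ?C (dual_schur_finite lam N)) =
        Determinant.det (mat N N (\<lambda>(i, j). ?A i (shifted_part lam N j))) *
        Determinant.det (mat N N (\<lambda>(i, j). ?B i (shifted_part lam N j)))"
      by (simp only:)
  qed
  then have S: "?X * ?Y * ?S = Determinant.det (mat N N (\<lambda>(i, j). \<Sum>\<alpha><M. ?A i \<alpha> * ?B j \<alpha>))"
    by (simp only: cauchy_binet_partitions)
  have "Determinant.det (mat N N (\<lambda>(i, j). 1 * ?T j * ?u i j)) =
      (\<Prod>j<N. ?T j) * (?X * ?Y * (\<Prod>i<N. \<Prod>j<N. ?u i j))"
    by (subst det_scale, subst det_cauchy [of N ?u "\<lambda>i. mfps_const (Var i)" mfps_var])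
       (simp_all add: mfps_geometric_inverse)
  also have "\<dots> = ?X * ?Y * (\<Prod>j<N. ?T j * (\<Prod>i<N. ?u i j))"
    unfolding prod.distrib by (subst prod.swap) (simp only: ac_simps)
  finally have K: "?X * ?Y * ?K = Determinant.det (mat N N (\<lambda>(i, j). 1 * ?T j * ?u i j))"
    by (simp only: dual_tail_0_times_geometric)
  have "vanish_below M ((\<Sum>\<alpha><M. ?A i \<alpha> * ?B j \<alpha>) - 1 * ?T j * ?u i j)" for i j
  proof -
    let ?xy = "1 - mfps_const (Var (Suc i)) * mfps_var (Suc j) :: xpoly mfps"
    let ?R = "mfps_const (factorial_power N (Suc i) M) * (mfps_var (Suc j) ^ M * dual_tail ?c N M (Suc j))"
    \<comment> \<open>Inserting 1 in this form makes the telescoping identity applicable; its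
      remainder \<open>?R\<close> carries the power \<open>M\<close> of y.\<close>
    have "(\<Sum>\<alpha><M. ?A i \<alpha> * ?B j \<alpha>) = (?u i j * ?xy) * (\<Sum>\<alpha><M. ?A i \<alpha> * ?B j \<alpha>)"
      by (simp only: mfps_geometric_inverse mult_1)
    also have "\<dots> = ?u i j * (?T j - ?R)"
      by (simp only: mult.assoc cauchy_telescope)
    finally have "(\<Sum>\<alpha><M. ?A i \<alpha> * ?B j \<alpha>) - 1 * ?T j * ?u i j = (- ?u i j) * ?R"
      by (simp add: algebra_simps)
    moreover have "vanish_below M ((- ?u i j) * ?R)"
      by (intro vanish_below_mult_left vanish_below_mult_right vanish_below_var_power)
    ultimately show ?thesis by simp
  qed
  then have "vanish_below M (?X * ?Y * ?S - ?X * ?Y * ?K)"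
    unfolding S K by (rule vanish_below_det_diff)
  moreover have "?X * ?Y * ?S - ?X * ?Y * ?K = ?Y * (?X * (?S - ?K))"
    by (simp add: algebra_simps)
  ultimately have "vanish_below (M - N * N + N * N) (?Y * (?X * (?S - ?K)))"
    using True by (simp only: le_add_diff_inverse2)
  then have "vanish_below (M - N * N) (?X * (?S - ?K))"
    by (rule vanish_below_vdm_cancel)
  \<comment> \<open>The Vandermonde product in x is a constant series, nonzero in an integral
    domain, so it cancels in each coefficient.\<close>
  then show ?thesis
    unfolding X [symmetric] by (simp add: vanish_below_def vdm_Var_nonzero)
qed (simp add: vanish_below_def)

section \<open>Passage to infinitely many variables\<close>

lemma coeff_dual_schur:
  assumes "lam \<in> partitions" "Poly_Mapping.keys m \<subseteq> {..N}"
  shows "mfps_coeff (dual_schur lam) m = mfps_coeff (dual_schur_finite lam N) m"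
  unfolding truncate_dual_schur [OF assms(1), symmetric] by (simp add: coeff_truncate assms(2))

text \<open>Setting \<open>x\<^sub>k = a\<^sub>k\<close> for \<open>k = N, N - 1, \<dots>, n + 1\<close> turns the identity with \<open>N\<close> variables
  \<open>x\<close> and \<open>y\<close> into the one with only \<open>n\<close> variables \<open>x\<close>.\<close>

lemma coeff_cauchy_identity:
  assumes m: "Poly_Mapping.keys m \<subseteq> {..N}" and M: "monom_degree m + N * N < M" and "n \<le> N"
  shows "(\<Sum>lam\<in>bounded_partitions N M. double_schur lam n * Const (mfps_coeff (dual_schur lam) m)) =
    mfps_coeff (cauchy_kernel n) m"
  using \<open>n \<le> N\<close>
proof (induction rule: inc_induct)
  case base
  have "monom_degree m < M - N * N" using M by simp
  then have "mfps_coeff (\<Sum>lam\<in>bounded_partitions N M.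
         mfps_const (double_schur lam N) * mfps_map Const (dual_schur_finite lam N)) m =
      mfps_coeff (\<Prod>j<N. cauchy_factor N (Suc j)) m"
    using truncated_cauchy_identity [of M N] by (simp add: vanish_below_def)
  moreover have "mfps_coeff (dual_schur lam) m = mfps_coeff (dual_schur_finite lam N) m"
    if "lam \<in> bounded_partitions N M" for lam
    using that m by (intro coeff_dual_schur) (auto simp: bounded_partitions_def)
  ultimately show ?case
    by (simp add: coeff_sum coeff_cauchy_kernel [OF m])
next
  case (step k)
  let ?h = "mpoly_subst (\<lambda>i. if i = Suc k then Const (avar (int (Suc k))) else Var i) :: xpoly \<Rightarrow> xpoly"
  have "(\<Sum>lam\<in>bounded_partitions N M. double_schur lam k * Const (mfps_coeff (dual_schur lam) m)) =
      ?h (\<Sum>lam\<in>bounded_partitions N M. double_schur lam (Suc k) * Const (mfps_coeff (dual_schur lam) m))"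
    unfolding mpoly_subst.hom_sum
  proof (rule sum.cong [OF refl])
    fix lam assume "lam \<in> bounded_partitions N M"
    then have "lam \<in> partitions" by (simp add: bounded_partitions_def)
    then show "double_schur lam k * Const (mfps_coeff (dual_schur lam) m) =
        ?h (double_schur lam (Suc k) * Const (mfps_coeff (dual_schur lam) m))"
      by (simp only: mpoly_subst.hom_mult double_schur_stable mpoly_subst_Const)
  qed
  also have "\<dots> = mfps_coeff (cauchy_kernel k) m"
    unfolding step.IH by (rule cauchy_kernel_stable)
  finally show ?case .
qed

text \<open>For a fixed monomial only finitely many partitions contribute, so its coefficient in the
  partial sums is eventually constant.\<close>

lemma has_sum_cauchy_kernel:
  "((\<lambda>lam. mfps_const (double_schur lam n) * mfps_map Const (dual_schur lam)) has_sum cauchy_kernel n) partitions"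
  unfolding has_sum_def
proof (rule tendsto_mfps)
  fix m :: "nat \<Rightarrow>\<^sub>0 nat"
  obtain t where t: "Poly_Mapping.keys m \<subseteq> {..t}" using finite_keys_bounded [of m] by blast
  define N where "N = Suc (max t n)"
  have m: "Poly_Mapping.keys m \<subseteq> {..N}" and "n \<le> N" and "0 < N"
    using t by (auto simp: N_def)
  \<comment> \<open>With this \<open>M\<close>, a partition with at most \<open>N\<close> parts
    outside \<open>?P\<close> has a dual Schur function of order above the degree of
    \<open>m\<close> in \<open>N\<close> variables.\<close>
  define M where "M = Suc (monom_degree m) + N * N"
  let ?P = "bounded_partitions N M"
  let ?f = "\<lambda>lam. mfps_const (double_schur lam n) * mfps_map Const (dual_schur lam)"
  have zero: "mfps_coeff (dual_schur lam) m = 0" if lam: "lam \<in> partitions" "lam \<notin> ?P" for lam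
  proof (cases "length lam \<le> N")
    case True
    with lam have "M < part lam 1 + N" by (auto simp: bounded_partitions_def)
    then have "vanish_below (Suc (monom_degree m)) (dual_schur_finite lam N)"
      by (intro vanish_below_dual_schur_finite [OF lam(1) _ \<open>0 < N\<close>]) (simp add: M_def)
    then show ?thesis
      by (simp add: coeff_dual_schur [OF lam(1) m] vanish_below_def)
  next
    case False
    then show ?thesis by (simp add: coeff_dual_schur [OF lam(1) m] dual_schur_finite_def)
  qed
  have "mfps_coeff (sum ?f F) m = mfps_coeff (cauchy_kernel n) m"
    if F: "finite F" "?P \<subseteq> F" "F \<subseteq> partitions" for F
  proof -
    have "mfps_coeff (sum ?f F) m = (\<Sum>lam\<in>F. double_schur lam n * Const (mfps_coeff (dual_schur lam) m))"
      by (simp add: coeff_sum)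
    also have "\<dots> = (\<Sum>lam\<in>?P. double_schur lam n * Const (mfps_coeff (dual_schur lam) m))"
      using F zero by (intro sum.mono_neutral_right) auto
    also have "\<dots> = mfps_coeff (cauchy_kernel n) m"
      by (rule coeff_cauchy_identity [OF m _ \<open>n \<le> N\<close>]) (simp add: M_def)
    finally show ?thesis .
  qed
  moreover have "?P \<subseteq> partitions" by (auto simp: bounded_partitions_def)
  ultimately show "\<forall>\<^sub>F F in finite_subsets_at_top partitions.
      mfps_coeff (sum ?f F) m = mfps_coeff (cauchy_kernel n) m"
    unfolding eventually_finite_subsets_at_top using finite_bounded_partitions [of N M] by blast
qed

text \<open>Product and sum are equated through a common limit \<open>K n\<close>, so that
  convergence of both is part of the claim. The variables y are numbered from 1, hence
  \<open>Suc j\<close>.\<close>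

theorem theorem3p1:
  shows "\<exists>K :: nat \<Rightarrow> xpoly mfps.
    (\<forall>n.
      (\<lambda>j. \<Prod>i=1..n. exact_quot
              (1 - mfps_const (Const (avar (int i))) * mfps_var (Suc j))
              (1 - mfps_const (Var i) * mfps_var (Suc j))) has_prod K n \<and>
      ((\<lambda>lam. mfps_const (double_schur lam n) * mfps_map Const (dual_schur lam))
        has_sum K n) partitions) \<and>
    (\<forall>m. (\<lambda>n. mfps_coeff (K n) m) \<in> double_symmetric_functions)"
proof -
  \<comment> \<open>The divisor is a unit with inverse \<open>mfps_geometric\<close>, so the
    quotient is a product with that series.\<close>
  have "(\<lambda>j. \<Prod>i=1..n. exact_quot
              (1 - mfps_const (Const (avar (int i))) * mfps_var (Suc j))
              (1 - mfps_const (Var i) * mfps_var (Suc j))) = (\<lambda>j. cauchy_factor n (Suc j))" for n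
    by (simp add: cauchy_factor_def exact_quot_unit [OF mfps_geometric_inverse])
  then show ?thesis
    using has_prod_cauchy_kernel has_sum_cauchy_kernel cauchy_kernel_double_symmetric
    by (intro exI [of _ cauchy_kernel]) simp
qed

end
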